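(* Let $K_{\aleph_0}^{(3)}$ be the complete $3$-uniform hypergraph on a countably infinite vertex set and let $G=\hat{K}_{2,4}^{(3)}$. Then the Strong Ramsey game $\mathcal{R}(K_{\aleph_0}^{(3)}, G)$ is a draw; that is, the second player $P_2$ has a strategy guaranteeing that the first player $P_1$ never claims all edges of a copy of $G$.
   Context: Strong Ramsey game $\mathcal{R}(B,G)$: $B$ (the board, possibly infinite) and $G$ (the target, finite) are $k$-uniform hypergraphs. Players $P_1$ and $P_2$ alternately claim (color) a previously unclaimed edge of $B$, with $P_1$ moving first. The first player to have claimed all edges of a copy of $G$ in $B$ wins; if neither player does so after finitely many moves, the game is a draw. (By strategy stealing $P_2$ cannot have a winning strategy, so "the game is a draw" means $P_2$ has a drawing strategy.) For $l\ge 3$, $\hat{K}_{2,l}$ is the graph obtained from the complete bipartite graph $K_{2,l}$ by adding the edge joining its two vertices of degree $l$. For a graph $H$ and $k\ge 2$, $H^{(k)}$ is the $k$-uniform hypergraph obtained by adding a fixed set $C$ of $k-2$ new vertices to every edge of $H$, i.e. $V(H^{(k)})=V(H)\cup C$ and $E(H^{(k)})=\{e\cup C: e\in E(H)\}$; the vertices of $C$ are called centers. Thus $\hat K_{2,4}^{(3)}$ has one center and $9$ edges. *)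

theory Defs
  imports Main
begin

definition complete_hypergraph :: "nat \<Rightarrow> 'a set \<Rightarrow> 'a set set" where
  "complete_hypergraph k V = {e. e \<subseteq> V \<and> card e = k}"

definition Khat2_vertices :: "nat \<Rightarrow> nat set" where
  "Khat2_vertices l = {0..l+1}"

definition Khat2_edges :: "nat \<Rightarrow> nat set set" where
  "Khat2_edges l = insert {0,1} ({{0,i} | i. i \<in> {2..l+1}} \<union> {{1,i} | i. i \<in> {2..l+1}})"

definition expansion :: "'a set \<Rightarrow> 'a set set \<Rightarrow> 'a set set" where
  "expansion C E = (\<lambda>e. e \<union> C) ` E"

definition G_vertices :: "nat set" where
  "G_vertices = Khat2_vertices 4 \<union> {6}"

definition G_edges :: "nat set set" where
  "G_edges = expansion {6} (Khat2_edges 4)"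

definition contains_copy :: "'a set \<Rightarrow> 'a set set \<Rightarrow> 'b set set \<Rightarrow> bool" where
  "contains_copy V E A \<longleftrightarrow> (\<exists>f. inj_on f V \<and> (\<lambda>e. f ` e) ` E \<subseteq> A)"

definition board :: "nat set set" where
  "board = complete_hypergraph 3 (UNIV :: nat set)"

text \<open>A play is a sequence of moves p 0, p 1, ...; P1 makes the moves with even
  index, P2 those with odd index. Edges claimed by each player after n moves:\<close>
definition P1_claims :: "(nat \<Rightarrow> 'e) \<Rightarrow> nat \<Rightarrow> 'e set" where
  "P1_claims p n = {p i | i. i < n \<and> even i}"

definition P2_claims :: "(nat \<Rightarrow> 'e) \<Rightarrow> nat \<Rightarrow> 'e set" where
  "P2_claims p n = {p i | i. i < n \<and> odd i}"

end

theory Submission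
  imports Defs
begin

text \<open>A copy of the target with \<open>n\<close> instead of four leaves is a \<^emph>\<open>book\<close>: a center \<open>c\<close>, two bases
  \<open>u\<close>, \<open>v\<close>, the edge \<open>{c, u, v}\<close> and the edges \<open>{c, u, t}\<close>, \<open>{c, v, t}\<close> for every leaf \<open>t\<close>. A player owning a
  book with three leaves (a \<^emph>\<open>core\<close>) can threaten for ever: she claims \<open>{c, u, t}\<close> with \<open>t\<close> fresh and the
  opponent has to answer \<open>{c, v, t}\<close>, an edge that is useless for him because every vertex of the target has
  degree at least two. So the second player is safe once she owns a core and is on move without being threatened.

  She builds the core with vertices avoiding the first edge \<open>f\<close> of \<open>P1\<close>. Every edge with which \<open>P1\<close> blocks her is then
  disjoint from \<open>f\<close>, so that \<open>f\<close> and the block never lie in a common copy, and blocking costs \<open>P1\<close> the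
  tempo he gained by starting. She gets a core after seven, eight or nine moves, when \<open>P1\<close> owns at
  most seven edges of any copy that is still possible. If \<open>P1\<close> then starts making threats, the edges
  through his center form a core plus pendant edges, and this rigid shape admits only single threats, each of which
  she can parry.\<close>

section \<open>Books and copies of the target\<close>

definition frame :: "'a \<Rightarrow> 'a \<Rightarrow> 'a \<Rightarrow> 'a set \<Rightarrow> nat \<Rightarrow> bool" where
  "frame c u v L n \<longleftrightarrow> c \<noteq> u \<and> c \<noteq> v \<and> u \<noteq> v \<and> c \<notin> L \<and> u \<notin> L \<and> v \<notin> L \<and> finite L \<and> card L = n"

definition book :: "'a \<Rightarrow> 'a \<Rightarrow> 'a \<Rightarrow> 'a set \<Rightarrow> 'a set set" where
  "book c u v L = insert {c, u, v} ((\<lambda>t. {c, u, t}) ` L \<union> (\<lambda>t. {c, v, t}) ` L)"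

definition has_copy :: "'a set set \<Rightarrow> bool" where
  "has_copy A \<longleftrightarrow> (\<exists>c u v L. frame c u v L 4 \<and> book c u v L \<subseteq> A)"

lemma frame_swap: "frame c u v L n \<Longrightarrow> frame c v u L n"
  by (auto simp: frame_def)

lemma book_swap: "book c u v L = book c v u L"
  by (auto simp: book_def insert_commute)

lemma center_in_book: "g \<in> book c u v L \<Longrightarrow> c \<in> g"
  by (auto simp: book_def)

lemma base_in_book: "g \<in> book c u v L \<Longrightarrow> u \<in> g \<or> v \<in> g"
  by (auto simp: book_def)

lemma book_insert: "book c u v (insert s L) = book c u v L \<union> {{c, u, s}, {c, v, s}}"
  by (auto simp: book_def)

lemma book_mono: "L \<subseteq> M \<Longrightarrow> book c u v L \<subseteq> book c u v M"
  by (auto simp: book_def)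

lemma frame_insert:
  "frame c u v L n \<Longrightarrow> s \<notin> {c, u, v} \<union> L \<Longrightarrow> frame c u v (insert s L) (Suc n)"
  by (auto simp: frame_def)

lemma frame_remove:
  "frame c u v L (Suc n) \<Longrightarrow> s \<in> L \<Longrightarrow> frame c u v (L - {s}) n"
  by (auto simp: frame_def)

lemma inj_on_triple: "inj_on (\<lambda>t. {a, b, t}) (- {a, b})"
  by (auto simp: inj_on_def)

lemma card_triples: "a \<notin> L \<Longrightarrow> b \<notin> L \<Longrightarrow> card ((\<lambda>t. {a, b, t}) ` L) = card L"
  by (intro card_image inj_on_subset[OF inj_on_triple]) auto

lemma finite_book: "frame c u v L n \<Longrightarrow> finite (book c u v L)"
  by (simp add: frame_def book_def)

lemma card_book:
  assumes "frame c u v L n"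
  shows "card (book c u v L) = 2 * n + 1"
proof -
  have d: "c \<noteq> u" "c \<noteq> v" "u \<noteq> v" "c \<notin> L" "u \<notin> L" "v \<notin> L" "finite L" "card L = n"
    using assms by (auto simp: frame_def)
  let ?U = "(\<lambda>t. {c, u, t}) ` L" and ?V = "(\<lambda>t. {c, v, t}) ` L"
  have "?U \<inter> ?V = {}" using d by auto
  then have 1: "card (?U \<union> ?V) = n + n"
    using d by (simp add: card_Un_disjoint card_triples)
  have "{c, u, v} \<notin> ?U \<union> ?V" using d by auto
  then show ?thesis
    using 1 d by (simp add: book_def)
qed

lemma not_has_copy_card_less:
  assumes "finite A" "card A < 9"
  shows "\<not> has_copy A"
proof
  assume "has_copy A"
  then obtain c u v L where "frame c u v L 4" "book c u v L \<subseteq> A"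
    by (auto simp: has_copy_def)
  then show False
    using card_mono[of A "book c u v L"] card_book[of c u v L 4] assms by simp
qed

text \<open>A copy has exactly nine edges, so it would be all of \<open>A\<close>; but its edges
  share the center, which \<open>f\<close> and \<open>g\<close> cannot.\<close>

lemma not_has_copy_disjoint:
  assumes "finite A" "card A \<le> 9" "f \<in> A" "g \<in> A" "f \<inter> g = {}"
  shows "\<not> has_copy A"
proof
  assume "has_copy A"
  then obtain c u v L where C: "frame c u v L 4" "book c u v L \<subseteq> A"
    by (auto simp: has_copy_def)
  moreover have "book c u v L = A"
    using C assms card_book[OF C(1)] by (intro card_seteq) auto
  ultimately show False
    using assms center_in_book[of _ c u v L] by blast
qed

lemma has_copy_mono: "has_copy A \<Longrightarrow> A \<subseteq> B \<Longrightarrow> has_copy B"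
  unfolding has_copy_def by blast

lemma book_image: "(`) f ` book c u v L = book (f c) (f u) (f v) (f ` L)"
  by (simp add: book_def image_Un image_image)

lemma G_edges_eq: "G_edges = book 6 0 1 {2..5}"
proof -
  have "Khat2_edges 4 = insert {0, 1} ((\<lambda>i. {0, i}) ` {2..5} \<union> (\<lambda>i. {1, i}) ` {2..5})"
    unfolding Khat2_edges_def by auto
  then show ?thesis
    by (simp add: G_edges_def expansion_def book_def image_Un image_image insert_commute)
qed

lemma G_vertices_eq: "G_vertices = {6, 0, 1} \<union> {2..5}"
  by (auto simp: G_vertices_def Khat2_vertices_def)

text \<open>The bridge from embeddings to books: 6 is the center, 0 and 1 are the bases, and the
  leaves 2 to 5 can be matched bijectively with any four leaves.\<close>

lemma contains_copy_iff: "contains_copy G_vertices G_edges A \<longleftrightarrow> has_copy A"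
proof
  assume "contains_copy G_vertices G_edges A"
  then obtain f where f: "inj_on f G_vertices" "book (f 6) (f 0) (f 1) (f ` {2..5}) \<subseteq> A"
    by (auto simp: contains_copy_def G_edges_eq book_image)
  have "card (f ` {2..5::nat}) = 4"
    using f(1) by (subst card_image) (auto simp: G_vertices_eq inj_on_Un)
  moreover have "f x \<noteq> f y" if "x \<in> G_vertices" "y \<in> G_vertices" "x \<noteq> y" for x y
    using that f(1) by (auto simp: inj_on_def)
  ultimately have "frame (f 6) (f 0) (f 1) (f ` {2..5}) 4"
    unfolding frame_def by (auto simp: G_vertices_eq)
  with f(2) show "has_copy A" by (auto simp: has_copy_def)
next
  assume "has_copy A"
  then obtain c u v L where C: "frame c u v L 4" "book c u v L \<subseteq> A"
    by (auto simp: has_copy_def)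
  then have "finite L" "card {2..5::nat} = card L" by (auto simp: frame_def)
  then obtain g where g: "bij_betw g {2..5::nat} L"
    using finite_same_card_bij[of "{2..5::nat}" L] by auto
  define f where "f = g(6 := c, 0 := u, 1 := v)"
  have fg: "f x = g x" if "x \<in> {2..5}" for x using that by (auto simp: f_def)
  have fL: "f ` {2..5} = L" using g fg by (auto simp: bij_betw_def)
  have "inj_on f {2..5}" using g fg by (auto simp: bij_betw_def inj_on_def)
  moreover have "f ` {6, 0, 1} \<inter> f ` {2..5} = {}" "inj_on f {6, 0, 1}"
    unfolding fL using C(1) by (auto simp: f_def frame_def)
  ultimately have "inj_on f G_vertices"
    unfolding G_vertices_eq by (intro inj_on_Un[THEN iffD2]) blast
  moreover have "(`) f ` G_edges = book c u v L"
    unfolding G_edges_eq book_image fL by (simp add: f_def)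
  ultimately show "contains_copy G_vertices G_edges A"
    using C(2) unfolding contains_copy_def by metis
qed

section \<open>The game as a predicate on positions\<close>

text \<open>\<open>holds A B\<close>: with \<open>P1\<close> on move, owning \<open>A\<close> against \<open>B\<close>, the second player can play on for ever
  without \<open>P1\<close> being the first to complete a copy.\<close>

coinductive holds :: "nat set set \<Rightarrow> nat set set \<Rightarrow> bool" where
  won: "has_copy B \<Longrightarrow> holds A B"
| reply: "(\<And>e. e \<in> board \<Longrightarrow> e \<notin> A \<union> B \<Longrightarrow> \<not> has_copy (insert e A) \<and>
     (\<exists>r \<in> board. r \<notin> insert e A \<union> B \<and> holds (insert e A) (insert r B))) \<Longrightarrow> holds A B"

definition position :: "nat set set \<Rightarrow> nat set set \<Rightarrow> bool" where
  "position A B \<longleftrightarrow> finite A \<and> finite B \<and> A \<subseteq> board \<and> B \<subseteq> board \<and> A \<inter> B = {}"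

lemma board_iff: "e \<in> board \<longleftrightarrow> card e = 3"
  by (simp add: board_def complete_hypergraph_def)

lemma triple_in_board: "distinct [a, b, d] \<Longrightarrow> {a, b, d} \<in> board"
  by (simp add: board_iff)

lemma position_move: "position A B \<Longrightarrow> e \<in> board \<Longrightarrow> e \<notin> A \<union> B \<Longrightarrow> position (insert e A) B"
  by (auto simp: position_def)

lemma position_reply: "position A B \<Longrightarrow> r \<in> board \<Longrightarrow> r \<notin> A \<union> B \<Longrightarrow> position A (insert r B)"
  by (auto simp: position_def)

lemma fresh_vertex:
  assumes "position A B" "finite S"
  obtains n where "n \<notin> \<Union>A" "n \<notin> \<Union>B" "n \<notin> S"
proof -
  have "finite e" if "e \<in> board" for e :: "nat set"
    using that by (intro card_ge_0_finite) (simp add: board_iff)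
  then have "finite (\<Union>A \<union> \<Union>B \<union> S)"
    using assms by (auto simp: position_def)
  from ex_new_if_finite[OF infinite_UNIV_nat this] show ?thesis using that by blast
qed

section \<open>Perpetual threats from a core\<close>

definition has_core :: "'a set set \<Rightarrow> bool" where
  "has_core B \<longleftrightarrow> (\<exists>c u v L. frame c u v L 3 \<and> book c u v L \<subseteq> B)"

text \<open>The pair is unordered because an edge \<open>{c, y, t}\<close> supplies half of a new
  leaf whether \<open>c\<close> or \<open>y\<close> is the center.\<close>

definition has_spine :: "'a set set \<Rightarrow> 'a \<Rightarrow> 'a \<Rightarrow> bool" where
  "has_spine A c y \<longleftrightarrow> (\<exists>d b b' L. frame d b b' L 3 \<and> book d b b' L \<subseteq> A \<and> {d, b} = {c, y})"

text \<open>Each \<open>t\<close> in \<open>T\<close> lies in only one edge of \<open>A\<close>,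
  while every vertex of a copy has degree at least two. So a copy using \<open>{c, y, t}\<close>
  needs \<open>e\<close> at \<open>t\<close> as well, and dropping the leaf \<open>t\<close> leaves
  a core inside \<open>A0\<close> with spine \<open>{c, y}\<close>.\<close>

lemma pendant_no_copy:
  assumes A: "A = A0 \<union> (\<lambda>t. {c, y, t}) ` T" and T: "T \<inter> \<Union>A0 = {}" "c \<notin> T" "y \<notin> T"
    and e: "e \<notin> A" "\<not> has_copy (insert e A0)" and sp: "\<not> has_spine A0 c y"
  shows "\<not> has_copy (insert e A)"
proof
  assume "has_copy (insert e A)"
  then obtain d u v M where F: "frame d u v M 4" and C: "book d u v M \<subseteq> insert e A"
    by (auto simp: has_copy_def)
  let ?C = "book d u v M"
  have d: "d \<noteq> u" "d \<noteq> v" "u \<noteq> v" "d \<notin> M" "u \<notin> M" "v \<notin> M" "finite M" "card M = 4"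
    using F by (auto simp: frame_def)
  have two: "g = {c, y, t} \<or> g = e" if "t \<in> T" "g \<in> ?C" "t \<in> g" for t g
  proof (rule ccontr)
    assume "\<not> ?thesis"
    then have "g \<in> A" "g \<noteq> {c, y, t}" using that C by auto
    then show False using that T A by auto
  qed
  have leaf: "t \<in> M \<and> ({d, u, t} = {c, y, t} \<and> {d, v, t} = e \<or> {d, v, t} = {c, y, t} \<and> {d, u, t} = e)"
    if t: "t \<in> T" "{c, y, t} \<in> ?C" for t
  proof -
    \<comment> \<open>The center lies in all nine edges of the copy and each base in at least four,
      so a vertex on at most two of them is a leaf.\<close>
    have small: "card S \<le> 2" if "S \<subseteq> ?C" "\<And>g. g \<in> S \<Longrightarrow> t \<in> g" for S
    proof -
      have "S \<subseteq> {{c, y, t}, e}" using two[OF t(1)] that by blast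
      then have "card S \<le> card {{c, y, t}, e}" by (intro card_mono) auto
      also have "\<dots> \<le> 2" by (simp add: card_insert_if)
      finally show ?thesis .
    qed
    have "t \<noteq> d"
      using small[of ?C] center_in_book[of _ d u v M] card_book[OF F] by auto
    moreover have "t \<noteq> u"
      using small[of "(\<lambda>s. {d, u, s}) ` M"] card_triples[of d M u] d by (auto simp: book_def)
    moreover have "t \<noteq> v"
      using small[of "(\<lambda>s. {d, v, s}) ` M"] card_triples[of d M v] d by (auto simp: book_def)
    ultimately have tM: "t \<in> M" using t(2) by (auto simp: book_def)
    then have "{d, u, t} \<in> ?C" "{d, v, t} \<in> ?C" "{d, u, t} \<noteq> {d, v, t}"
      using d by (auto simp: book_def)
    moreover from this have "{d, u, t} = {c, y, t} \<or> {d, u, t} = e" "{d, v, t} = {c, y, t} \<or> {d, v, t} = e"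
      by (rule_tac [!] two[OF t(1)]) simp_all
    ultimately show ?thesis using tM by metis
  qed
  have False if F: "frame d b b' M 4" and C': "?C = book d b b' M" and t: "t \<in> T" "t \<in> M"
    "{d, b, t} = {c, y, t}" "{d, b', t} = e" for b b' t
  proof -
    have "frame d b b' (M - {t}) 3" using frame_remove[of d b b' M 3 t] F t by simp
    moreover have "{d, b} = {c, y}"
    proof -
      have "t \<notin> {d, b}" "t \<notin> {c, y}" using F t T by (auto simp: frame_def)
      then show ?thesis using t(3) by blast
    qed
    moreover have "book d b b' (M - {t}) \<subseteq> A0"
    proof
      fix g assume g: "g \<in> book d b b' (M - {t})"
      then have gC: "g \<in> ?C" using book_mono[of "M - {t}" M] C' by blast
      have "t \<notin> g" using g F t(2) by (auto simp: book_def frame_def)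
      then have "g \<noteq> e" using t by auto
      show "g \<in> A0"
      proof (rule ccontr)
        assume "g \<notin> A0"
        \<comment> \<open>A second pendant edge would force its vertex into \<open>e\<close> too,
          but \<open>t\<close> is the only leaf in \<open>e\<close>.\<close>
        then obtain t' where t': "t' \<in> T" "g = {c, y, t'}" using gC C \<open>g \<noteq> e\<close> A by auto
        then have "t' \<in> M" "t' \<in> e" using leaf[of t'] gC by blast+
        then have "t' = t" using t(4) F by (auto simp: frame_def)
        then show False using t' \<open>t \<notin> g\<close> by simp
      qed
    qed
    ultimately show False using sp unfolding has_spine_def by blast
  qed
  note * = this
  have "\<not> ?C \<subseteq> insert e A0" using e(2) F by (auto simp: has_copy_def)
  then obtain t where "t \<in> T" "{c, y, t} \<in> ?C" using C A by auto
  from leaf[OF this] show False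
    using *[OF F refl \<open>t \<in> T\<close>] *[OF frame_swap[OF F] book_swap \<open>t \<in> T\<close>] by metis
qed

text \<open>\<open>P2\<close> owns a core and threatens \<open>{c, y, s}\<close>; the edges over \<open>T\<close> are the forced answers so far, and
  \<open>A0\<close> is what \<open>P1\<close> owned before. A spine \<open>{c, y}\<close> in \<open>A0\<close> must be excluded since
  a forced answer would extend it.\<close>

definition chase :: "nat set set \<Rightarrow> nat set set \<Rightarrow> bool" where
  "chase A B \<longleftrightarrow> position A B \<and> (\<exists>c x y L s A0 T. frame c x y L 3 \<and> book c x y L \<subseteq> B \<and>
     {c, x, s} \<in> B \<and> s \<notin> {c, x, y} \<union> L \<and> {c, y, s} \<notin> A \<union> B \<and> s \<notin> \<Union>A0 \<and>
     A = A0 \<union> (\<lambda>t. {c, y, t}) ` T \<and> T \<inter> \<Union>A0 = {} \<and> c \<notin> T \<and> y \<notin> T \<and>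
     (\<forall>r. r \<notin> B \<longrightarrow> \<not> has_copy (insert r A0)) \<and> \<not> has_spine A0 c y)"

lemma chaseI:
  assumes "position A B" "frame c x y L 3" "book c x y L \<subseteq> B" "{c, x, s} \<in> B" "s \<notin> {c, x, y} \<union> L"
    "{c, y, s} \<notin> A \<union> B" "s \<notin> \<Union>A0" "A = A0 \<union> (\<lambda>t. {c, y, t}) ` T" "T \<inter> \<Union>A0 = {}" "c \<notin> T" "y \<notin> T"
    "\<forall>r. r \<notin> B \<longrightarrow> \<not> has_copy (insert r A0)" "\<not> has_spine A0 c y"
  shows "chase A B"
  unfolding chase_def
  by (intro conjI exI[of _ c] exI[of _ x] exI[of _ y] exI[of _ L] exI[of _ s] exI[of _ A0] exI[of _ T]; fact)

text \<open>If \<open>P1\<close> ignores the threat, \<open>{c, y, s}\<close> completes a copy. If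
  he answers it, \<open>s\<close> joins \<open>T\<close>, and \<open>{c, x, n}\<close> with
  \<open>n\<close> fresh renews the threat while \<open>A0\<close> stays the same.\<close>

lemma chase_holds: "chase A B \<Longrightarrow> holds A B"
proof (coinduction arbitrary: A B rule: holds.coinduct)
  case (holds A B)
  then obtain c x y L s A0 T where pos: "position A B" and F: "frame c x y L 3"
    and core: "book c x y L \<subseteq> B" "{c, x, s} \<in> B" and s: "s \<notin> {c, x, y} \<union> L" "{c, y, s} \<notin> A \<union> B" "s \<notin> \<Union>A0"
    and A: "A = A0 \<union> (\<lambda>t. {c, y, t}) ` T" and T: "T \<inter> \<Union>A0 = {}" "c \<notin> T" "y \<notin> T"
    and r: "\<forall>r. r \<notin> B \<longrightarrow> \<not> has_copy (insert r A0)" and sp: "\<not> has_spine A0 c y"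
    unfolding chase_def by blast
  have d: "c \<noteq> x" "c \<noteq> y" "x \<noteq> y" using F by (auto simp: frame_def)
  have "\<exists>r\<in>board. r \<notin> insert e A \<union> B \<and> (chase (insert e A) (insert r B) \<or> holds (insert e A) (insert r B))"
    if e: "e \<in> board" "e \<notin> A \<union> B" for e
  proof (cases "e = {c, y, s}")
    case False
    have "frame c x y (insert s L) 4" using frame_insert[OF F s(1)] by simp
    moreover have "book c x y (insert s L) \<subseteq> insert {c, y, s} B"
      using core by (auto simp: book_insert)
    ultimately have "holds (insert e A) (insert {c, y, s} B)"
      by (intro won) (unfold has_copy_def, blast)
    moreover have "{c, y, s} \<in> board" using d s by (intro triple_in_board) auto
    moreover have "{c, y, s} \<notin> insert e A \<union> B" using s(2) False by simp
    ultimately show ?thesis by metis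
  next
    case True
    have pos': "position (insert e A) B" using pos e by (rule position_move)
    obtain n where n: "n \<notin> \<Union>(insert e A)" "n \<notin> \<Union>B" "n \<notin> {c, x, y} \<union> L"
      using F by (rule_tac fresh_vertex[OF pos', of "{c, x, y} \<union> L"]) (auto simp: frame_def)
    let ?r = "{c, x, n}"
    have rb: "?r \<in> board" using d n by (intro triple_in_board) auto
    have rn: "?r \<notin> insert e A \<union> B" using n by blast
    have "position (insert e A) (insert ?r B)" using pos' rb rn by (rule position_reply)
    moreover have "{c, y, n} \<notin> insert e A \<union> insert ?r B"
      using n d by (auto simp: doubleton_eq_iff)
    moreover have "n \<notin> \<Union>A0" using n A by auto
    moreover have "insert e A = A0 \<union> (\<lambda>t. {c, y, t}) ` (insert s T)" using A True by auto
    moreover have "insert s T \<inter> \<Union>A0 = {}" "c \<notin> insert s T" "y \<notin> insert s T" using s T by auto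
    moreover have "book c x y L \<subseteq> insert ?r B" using core by auto
    moreover have "\<forall>r. r \<notin> insert ?r B \<longrightarrow> \<not> has_copy (insert r A0)" using r by auto
    ultimately have "chase (insert e A) (insert ?r B)"
      using F n(3) sp by (intro chaseI[of _ _ c x y L n A0 "insert s T"]) (assumption | simp only: insertI1)+
    then show ?thesis using rb rn by metis
  qed
  moreover have "\<not> has_copy (insert e A)" if "e \<notin> A \<union> B" for e
    using pendant_no_copy[OF A T _ _ sp, of e] r that by auto
  ultimately have "\<forall>e. e \<in> board \<longrightarrow> e \<notin> A \<union> B \<longrightarrow> \<not> has_copy (insert e A) \<and> (\<exists>r\<in>board. r \<notin> insert e A \<union> B \<and>
    (chase (insert e A) (insert r B) \<or> holds (insert e A) (insert r B)))" by metis
  then show ?case by simp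
qed

text \<open>\<open>P2\<close> may choose which base collects the forced answers, so one of the two
  spines may be present. The chase starts with \<open>A0 = A\<close> and \<open>T\<close>
  empty.\<close>

lemma start_chase:
  assumes pos: "position A B" and F: "frame c x y L 3" "book c x y L \<subseteq> B"
    and r: "\<And>r. r \<notin> B \<Longrightarrow> \<not> has_copy (insert r A)"
    and sp: "\<not> (has_spine A c x \<and> has_spine A c y)"
  shows "\<exists>r \<in> board. r \<notin> A \<union> B \<and> holds A (insert r B)"
proof -
  have *: "\<exists>r \<in> board. r \<notin> A \<union> B \<and> holds A (insert r B)"
    if F: "frame c x y L 3" "book c x y L \<subseteq> B" and sp: "\<not> has_spine A c y" for x y
  proof -
    have d: "c \<noteq> x" "c \<noteq> y" "x \<noteq> y" using F by (auto simp: frame_def)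
    obtain n where n: "n \<notin> \<Union>A" "n \<notin> \<Union>B" "n \<notin> {c, x, y} \<union> L"
      using F by (rule_tac fresh_vertex[OF pos, of "{c, x, y} \<union> L"]) (auto simp: frame_def)
    let ?r = "{c, x, n}"
    have rb: "?r \<in> board" using d n by (intro triple_in_board) auto
    have rn: "?r \<notin> A \<union> B" using n by blast
    have "position A (insert ?r B)" using pos rb rn by (rule position_reply)
    moreover have "{c, y, n} \<notin> A \<union> insert ?r B"
      using n d by (auto simp: doubleton_eq_iff)
    moreover have "book c x y L \<subseteq> insert ?r B" using F by auto
    moreover have "\<forall>r. r \<notin> insert ?r B \<longrightarrow> \<not> has_copy (insert r A)" using r by auto
    moreover have "A = A \<union> (\<lambda>t. {c, y, t}) ` {}" "{} \<inter> \<Union>A = {}" "c \<notin> {}" "y \<notin> {}" by auto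
    ultimately have "chase A (insert ?r B)"
      using F(1) n sp by (intro chaseI[of _ _ c x y L n A "{}"]) (assumption | simp only: insertI1)+
    then show ?thesis using rb rn chase_holds by blast
  qed
  show ?thesis
    using *[OF F] *[OF frame_swap[OF F(1)]] F(2) book_swap[of c x y L] sp by auto
qed

section \<open>Rigid positions of \<open>P1\<close>\<close>

definition meet_once :: "'a set \<Rightarrow> 'a set \<Rightarrow> bool" where
  "meet_once g h \<longleftrightarrow> (\<forall>a \<in> g \<inter> h. \<forall>b \<in> g \<inter> h. a = b)"

text \<open>The position of \<open>P1\<close> while he makes threats: in the link of \<open>c\<close> all his edges meet \<open>{u, v}\<close>, and
  either \<open>P2\<close> owns the base edge or at most three leaves are complete while the others are blocked.\<close>

definition rigid :: "'a set set \<Rightarrow> 'a set set \<Rightarrow> 'a \<Rightarrow> 'a \<Rightarrow> 'a \<Rightarrow> bool" where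
  "rigid A B c u v \<longleftrightarrow> c \<noteq> u \<and> c \<noteq> v \<and> u \<noteq> v \<and>
     (\<forall>g \<in> A. c \<in> g \<longrightarrow> u \<in> g \<or> v \<in> g) \<and>
     (\<forall>g \<in> A. \<forall>h \<in> A. c \<notin> g \<longrightarrow> c \<notin> h \<longrightarrow> g \<noteq> h \<longrightarrow> meet_once g h) \<and>
     ({c, u, v} \<in> B \<or>
      (\<exists>M. finite M \<and> card M \<le> 3 \<and> (\<forall>t. t \<notin> {c, u, v} \<and> {c, u, t} \<in> A \<and> {c, v, t} \<in> A \<longrightarrow> t \<in> M)) \<and>
      (\<forall>t. t \<notin> {c, u, v} \<longrightarrow> ({c, u, t} \<in> A \<longrightarrow> {c, v, t} \<in> A \<union> B) \<and> ({c, v, t} \<in> A \<longrightarrow> {c, u, t} \<in> A \<union> B)))"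

lemma rigid_swap: "rigid A B c u v \<Longrightarrow> rigid A B c v u"
proof -
  assume R: "rigid A B c u v"
  have eq: "{c, v, u} = {c, u, v}" by auto
  from R show "rigid A B c v u"
    unfolding rigid_def eq by (simp add: conj_commute) blast
qed

text \<open>Count the star of the \<open>n + 1\<close> edges \<open>{d, b, t}\<close> with
  \<open>t\<close> a leaf or \<open>b'\<close>. If \<open>c\<close> is neither \<open>d\<close> nor
  \<open>b\<close>, at least \<open>n\<close> of them avoid \<open>c\<close>; these pairwise share
  two vertices, so \<open>A\<close> supplies at most one and \<open>R\<close> is too small for the
  rest. Since \<open>c\<close> cannot be both bases, \<open>d = c\<close> follows. If then
  \<open>b\<close> is outside \<open>{u, v}\<close>, at least \<open>n - 1\<close> star edges avoid
  \<open>u\<close> and \<open>v\<close> and would all lie in \<open>R\<close>.\<close>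

lemma rigid_kernel:
  assumes R: "rigid A B c u v" and F: "frame d b b' L n" "book d b b' L \<subseteq> A \<union> R"
    and fin: "finite R" "card R + 2 \<le> n"
  shows "d = c \<and> {b, b'} = {u, v}"
proof -
  have cuv: "c \<noteq> u" "c \<noteq> v" "u \<noteq> v"
    and J1: "\<And>g. g \<in> A \<Longrightarrow> c \<in> g \<Longrightarrow> u \<in> g \<or> v \<in> g"
    and J2: "\<And>g h. g \<in> A \<Longrightarrow> h \<in> A \<Longrightarrow> c \<notin> g \<Longrightarrow> c \<notin> h \<Longrightarrow> g \<noteq> h \<Longrightarrow> meet_once g h"
    using R unfolding rigid_def by blast+
  have star: "(\<lambda>t. {d, b, t}) ` insert b' L \<subseteq> A \<union> R"
      "d \<noteq> b" "card (insert b' L) = n + 1" "finite L" "d \<notin> insert b' L" "b \<notin> insert b' L"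
    if "frame d b b' L n" "book d b b' L \<subseteq> A \<union> R" for b b'
    using that by (auto simp: frame_def book_def)
  have False if F: "frame d b b' L n" "book d b b' L \<subseteq> A \<union> R" and "d \<noteq> c" "b \<noteq> c" for b b'
  proof -
    note s = star[OF F]
    let ?S = "(\<lambda>t. {d, b, t}) ` (insert b' L - {c})"
    have "n \<le> card (insert b' L - {c})"
      using s(3) diff_card_le_card_Diff[of "{c}" "insert b' L"] by simp
    also have "\<dots> = card ?S" using s by (subst card_triples) auto
    also have "\<dots> \<le> card ((?S - R) \<union> R)" using s fin by (intro card_mono) auto
    also have "\<dots> \<le> card (?S - R) + card R" by (rule card_Un_le)
    also have "card (?S - R) \<le> Suc 0"
    proof (subst card_le_Suc0_iff_eq)
      show "finite (?S - R)" using s by auto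
      show "\<forall>g \<in> ?S - R. \<forall>h \<in> ?S - R. g = h"
      proof (intro ballI, rule ccontr)
        fix g h assume gh: "g \<in> ?S - R" "h \<in> ?S - R" "g \<noteq> h"
        then have "g \<in> A" "h \<in> A" "c \<notin> g" "c \<notin> h" using s(1) that by auto
        then have "meet_once g h" using J2 gh by blast
        then show False using gh s(2) by (auto simp: meet_once_def)
      qed
    qed
    finally show False using fin by simp
  qed
  note * = this
  have dc: "d = c"
  proof (rule ccontr)
    assume "d \<noteq> c"
    then have "b = c" using *[OF F] by auto
    moreover have "b' = c"
      using *[OF frame_swap[OF F(1)]] F(2) \<open>d \<noteq> c\<close> unfolding book_swap[of d b' b] by auto
    ultimately show False using F(1) by (simp add: frame_def)
  qed
  have **: "b \<in> {u, v}" if F: "frame d b b' L n" "book d b b' L \<subseteq> A \<union> R" for b b'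
  proof (rule ccontr)
    assume b: "b \<notin> {u, v}"
    note s = star[OF F]
    let ?S = "(\<lambda>t. {d, b, t}) ` (insert b' L - {u, v})"
    have "n + 1 - 2 \<le> card (insert b' L - {u, v})"
      using s(3) diff_card_le_card_Diff[of "{u, v}" "insert b' L"] cuv by simp
    also have "\<dots> = card ?S" using s by (subst card_triples) auto
    also have "?S \<subseteq> R"
    proof
      fix g assume g: "g \<in> ?S"
      then have "g \<in> A \<union> R" using s(1) by auto
      moreover have "c \<in> g" "u \<notin> g" "v \<notin> g" using g dc b cuv by auto
      ultimately show "g \<in> R" using J1 by blast
    qed
    then have "card ?S \<le> card R" using fin by (intro card_mono)
    finally show False using fin by simp
  qed
  have "b \<in> {u, v}" "b' \<in> {u, v}" "b \<noteq> b'"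
    using **[OF F] **[OF frame_swap[OF F(1)]] F book_swap[of d b b' L] by (auto simp: frame_def)
  then show ?thesis using dc by auto
qed

text \<open>By \<open>rigid_kernel\<close> the copy has center \<open>c\<close> and bases
  \<open>u\<close>, \<open>v\<close>, so \<open>{c, u, v}\<close> is not in \<open>B\<close>. At
  most three leaves are complete in \<open>A\<close> and half-complete ones are blocked, so some
  leaf \<open>t\<close> of the copy takes both its edges from \<open>e\<close> and \<open>r\<close>.
  Hence no single move completes a copy and a threat has only one answer.\<close>

lemma rigid_threat:
  assumes R: "rigid A B c u v" and copy: "has_copy (insert r (insert e A))"
    and B: "insert r (insert e A) \<inter> B = {}"
  obtains t where "t \<notin> {c, u, v}" "{e, r} = {{c, u, t}, {c, v, t}}" "e \<noteq> r" "e \<notin> A" "r \<notin> A"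
proof -
  obtain d b b' L where F: "frame d b b' L 4" "book d b b' L \<subseteq> insert r (insert e A)"
    using copy by (auto simp: has_copy_def)
  have "card {e, r} \<le> 2" by (simp add: card_insert_if)
  then have "d = c \<and> {b, b'} = {u, v}"
    using F by (intro rigid_kernel[OF R, of d b b' L 4 "{e, r}"]) auto
  then have "frame c u v L 4 \<and> book c u v L \<subseteq> insert r (insert e A)"
    using F frame_swap[of d b b' L 4] book_swap[of d b b' L] by (auto simp: doubleton_eq_iff)
  then have F: "frame c u v L 4" and C: "book c u v L \<subseteq> insert r (insert e A)" by auto
  have "{c, u, v} \<notin> B" using C B by (auto simp: book_def)
  then obtain M where M: "finite M" "card M \<le> 3" "\<And>t. t \<notin> {c, u, v} \<Longrightarrow> {c, u, t} \<in> A \<Longrightarrow> {c, v, t} \<in> A \<Longrightarrow> t \<in> M"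
    and P: "\<And>t. t \<notin> {c, u, v} \<Longrightarrow> ({c, u, t} \<in> A \<longrightarrow> {c, v, t} \<in> A \<union> B) \<and> ({c, v, t} \<in> A \<longrightarrow> {c, u, t} \<in> A \<union> B)"
    using R unfolding rigid_def by blast
  have "\<not> L \<subseteq> M" using M F card_mono[of M L] by (auto simp: frame_def)
  then obtain t where t: "t \<in> L" "t \<notin> M" by auto
  have tn: "t \<notin> {c, u, v}" and ne: "{c, u, t} \<noteq> {c, v, t}" using t F by (auto simp: frame_def)
  have in1: "{c, u, t} \<in> insert r (insert e A)" "{c, v, t} \<in> insert r (insert e A)"
    using C t by (auto simp: book_def)
  then have "{c, u, t} \<notin> A" "{c, v, t} \<notin> A" using P[OF tn] M(3)[OF tn] t B by blast+
  with in1 ne have "{c, u, t} = e \<and> {c, v, t} = r \<or> {c, u, t} = r \<and> {c, v, t} = e" by auto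
  then show ?thesis
    using that[of t] tn ne \<open>{c, u, t} \<notin> A\<close> \<open>{c, v, t} \<notin> A\<close> by auto
qed

lemma triple_neq:
  assumes "c \<noteq> u" "u \<noteq> v" "t \<notin> {c, u, v}"
  shows "{c, v, s} \<noteq> {c, u, t}"
proof
  assume eq: "{c, v, s} = {c, u, t}"
  have "u \<in> {c, v, s}" "t \<in> {c, v, s}" unfolding eq by auto
  then show False using assms by auto
qed

lemma triple_inj:
  assumes "{c, u, s} = {c, u, t}" "t \<notin> {c, u}"
  shows "s = t"
proof -
  have "t \<in> {c, u, s}" unfolding assms(1) by simp
  then show ?thesis using assms(2) by auto
qed

text \<open>The leaf \<open>t\<close> gets one edge from each player: no further leaf becomes
  complete, and \<open>t\<close> is blocked.\<close>

lemma rigid_extend: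
  assumes R: "rigid A B c u v" and t: "t \<notin> {c, u, v}" and n: "{c, v, t} \<notin> A"
  shows "rigid (insert {c, u, t} A) (insert {c, v, t} B) c u v"
proof -
  have cuv: "c \<noteq> u" "c \<noteq> v" "u \<noteq> v"
    and J1: "\<forall>g \<in> A. c \<in> g \<longrightarrow> u \<in> g \<or> v \<in> g"
    and J2: "\<forall>g \<in> A. \<forall>h \<in> A. c \<notin> g \<longrightarrow> c \<notin> h \<longrightarrow> g \<noteq> h \<longrightarrow> meet_once g h"
    and J3: "{c, u, v} \<in> B \<or>
      (\<exists>M. finite M \<and> card M \<le> 3 \<and> (\<forall>t. t \<notin> {c, u, v} \<and> {c, u, t} \<in> A \<and> {c, v, t} \<in> A \<longrightarrow> t \<in> M)) \<and>
      (\<forall>t. t \<notin> {c, u, v} \<longrightarrow> ({c, u, t} \<in> A \<longrightarrow> {c, v, t} \<in> A \<union> B) \<and> ({c, v, t} \<in> A \<longrightarrow> {c, u, t} \<in> A \<union> B))"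
    using R unfolding rigid_def by blast+
  have M: "{c, u, s} \<in> A \<and> {c, v, s} \<in> A" if "{c, u, s} \<in> insert {c, u, t} A \<and> {c, v, s} \<in> insert {c, u, t} A" for s
  proof -
    have "{c, v, s} \<noteq> {c, u, t}" by (rule triple_neq) (use cuv t in auto)
    then have "{c, v, s} \<in> A" using that by simp
    moreover from this have "s \<noteq> t" using n by metis
    then have "{c, u, s} \<noteq> {c, u, t}" using triple_inj[of c u s t] t by auto
    ultimately show ?thesis using that by simp
  qed
  have P: "({c, u, s} \<in> insert {c, u, t} A \<longrightarrow> {c, v, s} \<in> insert {c, u, t} A \<union> insert {c, v, t} B) \<and>
      ({c, v, s} \<in> insert {c, u, t} A \<longrightarrow> {c, u, s} \<in> insert {c, u, t} A \<union> insert {c, v, t} B)"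
    if "({c, u, s} \<in> A \<longrightarrow> {c, v, s} \<in> A \<union> B) \<and> ({c, v, s} \<in> A \<longrightarrow> {c, u, s} \<in> A \<union> B)" for s
  proof -
    have "{c, v, s} \<noteq> {c, u, t}" by (rule triple_neq) (use cuv t in auto)
    moreover have "s = t" if "{c, u, s} = {c, u, t}" using triple_inj[OF that] t by auto
    ultimately show ?thesis using that by (metis Un_iff insert_iff)
  qed
  have J3': "{c, u, v} \<in> insert {c, v, t} B \<or>
      (\<exists>M. finite M \<and> card M \<le> 3 \<and> (\<forall>s. s \<notin> {c, u, v} \<and> {c, u, s} \<in> insert {c, u, t} A \<and> {c, v, s} \<in> insert {c, u, t} A \<longrightarrow> s \<in> M)) \<and>
      (\<forall>s. s \<notin> {c, u, v} \<longrightarrow> ({c, u, s} \<in> insert {c, u, t} A \<longrightarrow> {c, v, s} \<in> insert {c, u, t} A \<union> insert {c, v, t} B) \<and>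
      ({c, v, s} \<in> insert {c, u, t} A \<longrightarrow> {c, u, s} \<in> insert {c, u, t} A \<union> insert {c, v, t} B))"
    using J3
  proof (elim disjE conjE exE)
    fix M assume "finite M" "card M \<le> 3" "\<forall>t. t \<notin> {c, u, v} \<and> {c, u, t} \<in> A \<and> {c, v, t} \<in> A \<longrightarrow> t \<in> M"
    then have 1: "finite M \<and> card M \<le> 3 \<and> (\<forall>s. s \<notin> {c, u, v} \<and> {c, u, s} \<in> insert {c, u, t} A \<and> {c, v, s} \<in> insert {c, u, t} A \<longrightarrow> s \<in> M)"
      using M by (metis (no_types))
    assume 2: "\<forall>t. t \<notin> {c, u, v} \<longrightarrow> ({c, u, t} \<in> A \<longrightarrow> {c, v, t} \<in> A \<union> B) \<and> ({c, v, t} \<in> A \<longrightarrow> {c, u, t} \<in> A \<union> B)"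
    show ?thesis
      using 1
    proof (intro disjI2 conjI[OF exI[of _ M]] allI impI)
      fix s assume "s \<notin> {c, u, v}"
      then show "({c, u, s} \<in> insert {c, u, t} A \<longrightarrow> {c, v, s} \<in> insert {c, u, t} A \<union> insert {c, v, t} B) \<and>
        ({c, v, s} \<in> insert {c, u, t} A \<longrightarrow> {c, u, s} \<in> insert {c, u, t} A \<union> insert {c, v, t} B)"
        by (rule P[OF 2[rule_format]])
    qed
  next
    assume "{c, u, v} \<in> B"
    then show ?thesis by (intro disjI1 insertI2)
  qed
  have "\<forall>g \<in> insert {c, u, t} A. c \<in> g \<longrightarrow> u \<in> g \<or> v \<in> g" using J1 by auto
  moreover have "\<forall>g \<in> insert {c, u, t} A. \<forall>h \<in> insert {c, u, t} A. c \<notin> g \<longrightarrow> c \<notin> h \<longrightarrow> g \<noteq> h \<longrightarrow> meet_once g h"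
    using J2 by auto
  ultimately show ?thesis
    unfolding rigid_def using cuv J3' by (intro conjI)
qed

text \<open>An edge at a leaf is answered by its partner whenever that is free, which keeps the
  position rigid. Any other move makes no threat, so \<open>P2\<close> can start the chase from her
  core.\<close>

lemma rigid_holds:
  "position A B \<Longrightarrow> has_core B \<Longrightarrow> rigid A B c u v \<Longrightarrow> holds A B"
proof (coinduction arbitrary: A B rule: holds.coinduct)
  case (holds A B)
  note pos = holds(1) and R = holds(3)
  have dj: "A \<inter> B = {}" using pos by (simp add: position_def)
  have cuv: "c \<noteq> u" "c \<noteq> v" "u \<noteq> v" using R by (auto simp: rigid_def)
  \<comment> \<open>The instance with both edges equal to \<open>e\<close>, whereas a completed copy
    needs two distinct ones.\<close>
  have no: "\<not> has_copy (insert e A)" if "e \<notin> A \<union> B" for e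
    using rigid_threat[OF R, of e e] that dj by auto
  have "\<exists>r\<in>board. r \<notin> insert e A \<union> B \<and> ((position (insert e A) (insert r B) \<and> has_core (insert r B) \<and>
      rigid (insert e A) (insert r B) c u v) \<or> holds (insert e A) (insert r B))"
    if e: "e \<in> board" "e \<notin> A \<union> B" for e
  proof (cases "\<exists>t r. t \<notin> {c, u, v} \<and> {e, r} = {{c, u, t}, {c, v, t}} \<and> r \<notin> A \<union> B")
    case True
    then obtain t r where t: "t \<notin> {c, u, v}" "{e, r} = {{c, u, t}, {c, v, t}}" "r \<notin> A \<union> B"
      by blast
    have er: "e = {c, u, t} \<and> r = {c, v, t} \<or> e = {c, v, t} \<and> r = {c, u, t}"
      using t(2) by (auto simp: doubleton_eq_iff)
    moreover have "{c, u, t} \<noteq> {c, v, t}" using t(1) cuv by auto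
    ultimately have "e \<noteq> r" by metis
    then have rn: "r \<notin> insert e A \<union> B" using t by blast
    have "{c, u, t} \<in> board" "{c, v, t} \<in> board" using t(1) cuv by (auto intro!: triple_in_board)
    then have rb: "r \<in> board" using er by auto
    have "position (insert e A) (insert r B)"
      using position_reply[OF position_move[OF pos e] rb rn] .
    moreover have "has_core (insert r B)" using holds(2) unfolding has_core_def by blast
    moreover have "rigid (insert e A) (insert r B) c u v"
      using er
    proof
      assume "e = {c, u, t} \<and> r = {c, v, t}"
      then show ?thesis using rigid_extend[OF R t(1)] t(3) by simp
    next
      assume "e = {c, v, t} \<and> r = {c, u, t}"
      then show ?thesis using rigid_extend[OF rigid_swap[OF R], of t] t by (auto intro: rigid_swap)
    qed
    ultimately show ?thesis using rb rn by blast
  next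
    case False
    have pos': "position (insert e A) B" using pos e by (rule position_move)
    obtain c' x y L where core: "frame c' x y L 3" "book c' x y L \<subseteq> B"
      using holds(2) by (auto simp: has_core_def)
    have safe: "\<not> has_copy (insert r (insert e A))" if r: "r \<notin> B" for r
    proof
      assume "has_copy (insert r (insert e A))"
      moreover have "insert r (insert e A) \<inter> B = {}" using r e dj by auto
      ultimately obtain t where "t \<notin> {c, u, v}" "{e, r} = {{c, u, t}, {c, v, t}}" "r \<notin> A"
        by (rule rigid_threat[OF R])
      then show False using False r by blast
    qed
    have spine: "{c', z} \<subseteq> {c, u, v} \<and> {c, u, v} \<in> insert e A" if z: "has_spine (insert e A) c' z" for z
    proof -
      obtain d b b' L where F: "frame d b b' L 3" "book d b b' L \<subseteq> insert e A" "{d, b} = {c', z}"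
        using z by (auto simp: has_spine_def)
      have "d = c \<and> {b, b'} = {u, v}"
        using F by (intro rigid_kernel[OF R, of d b b' L 3 "{e}"]) auto
      then have "{d, b, b'} = {c, u, v}" "{d, b} \<subseteq> {c, u, v}" by auto
      moreover have "{d, b, b'} \<in> insert e A" using F(2) by (auto simp: book_def)
      ultimately show ?thesis using F(3) by simp
    qed
    \<comment> \<open>Two spines would give \<open>{c', x, y} = {c, u, v}\<close>, an edge then
      owned by both players.\<close>
    have "\<not> (has_spine (insert e A) c' x \<and> has_spine (insert e A) c' y)"
    proof
      assume "has_spine (insert e A) c' x \<and> has_spine (insert e A) c' y"
      then have sub: "{c', x, y} \<subseteq> {c, u, v}" and "{c, u, v} \<in> insert e A"
        using spine[of x] spine[of y] by auto
      moreover have "{c', x, y} = {c, u, v}"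
        using sub core(1) cuv by (intro card_subset_eq) (auto simp: frame_def)
      moreover have "{c', x, y} \<in> B" using core(2) by (auto simp: book_def)
      ultimately show False using pos' by (auto simp: position_def)
    qed
    then show ?thesis using start_chase[OF pos' core safe] by blast
  qed
  with no have "\<forall>e. e \<in> board \<longrightarrow> e \<notin> A \<union> B \<longrightarrow> \<not> has_copy (insert e A) \<and> (\<exists>r\<in>board. r \<notin> insert e A \<union> B \<and>
      ((position (insert e A) (insert r B) \<and> has_core (insert r B) \<and>
      rigid (insert e A) (insert r B) c u v) \<or> holds (insert e A) (insert r B)))" by metis
  then show ?case by simp
qed

section \<open>Positions settled by a core\<close>

text \<open>As \<open>{c, x, y}\<close> belongs to \<open>B\<close>, none of the seven edges of the
  core over \<open>{c, y}\<close> contains \<open>x\<close>, whereas the core over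
  \<open>{c, x}\<close> has four edges \<open>{c, x, t}\<close>.\<close>

lemma spines_card:
  assumes fin: "finite A" "A \<inter> B = {}" and B: "{c, x, y} \<in> B" and ne: "c \<noteq> x" "c \<noteq> y" "x \<noteq> y"
    and sp: "has_spine A c x" "has_spine A c y"
  shows "11 \<le> card A"
proof -
  obtain d b b' L where K: "frame d b b' L 3" "book d b b' L \<subseteq> A" "{d, b} = {c, y}"
    using sp(2) by (auto simp: has_spine_def)
  obtain d2 b2 b2' L2 where K2: "frame d2 b2 b2' L2 3" "book d2 b2 b2' L2 \<subseteq> A" "{d2, b2} = {c, x}"
    using sp(1) by (auto simp: has_spine_def)
  have e: "{d, b, t} = {c, y, t}" for t using K(3) by (metis insert_commute)
  have "x \<notin> insert b' L"
  proof
    assume "x \<in> insert b' L"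
    then have "{d, b, x} \<in> A" using K(2) by (auto simp: book_def)
    then have "{c, x, y} \<in> A" unfolding e by (simp add: insert_commute)
    then show False using B fin by blast
  qed
  moreover have "x \<notin> {d, b}" unfolding K(3) using ne by simp
  ultimately have x: "x \<notin> g" if "g \<in> book d b b' L" for g
    using that by (auto simp: book_def)
  let ?S = "(\<lambda>t. {d2, b2, t}) ` insert b2' L2"
  have "x \<in> {d2, b2}" unfolding K2(3) by simp
  then have "x \<in> g" if "g \<in> ?S" for g using that by auto
  then have dj: "book d b b' L \<inter> ?S = {}" using x by blast
  have S: "?S \<subseteq> A" using K2(2) by (auto simp: book_def)
  have "card ?S = 4" using K2(1) by (subst card_triples) (auto simp: frame_def)
  then have "card (book d b b' L \<union> ?S) = 11"
    using dj card_book[OF K(1)] finite_book[OF K(1)] K2(1) by (subst card_Un_disjoint) (auto simp: frame_def)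
  moreover have "card (book d b b' L \<union> ?S) \<le> card A"
    using K(2) S fin by (intro card_mono) auto
  ultimately show ?thesis by simp
qed

text \<open>With at most six edges of a book \<open>C\<close>, the next move of \<open>P1\<close>
  makes no threat in \<open>C\<close>. With seven it may, and the condition on his other edges is
  what \<open>rigid\<close> demands once \<open>P2\<close> has blocked; \<open>d\<close> stands for
  the center of \<open>C\<close>.\<close>

definition controlled :: "'a set set \<Rightarrow> 'a set set \<Rightarrow> 'a \<Rightarrow> bool" where
  "controlled A C d \<longleftrightarrow> card (A \<inter> C) \<le> 6 \<or>
     card (A \<inter> C) = 7 \<and> (\<forall>g \<in> A - C. d \<notin> g \<and> (\<forall>h \<in> A - C. g \<noteq> h \<longrightarrow> meet_once g h))"

text \<open>Only books disjoint from \<open>B\<close> can still become copies of \<open>P1\<close>.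
  The bound nine gives him at most ten edges after his next move, one short of the count in
  \<open>spines_card\<close>.\<close>

definition settled :: "'a set set \<Rightarrow> 'a set set \<Rightarrow> bool" where
  "settled A B \<longleftrightarrow> card A \<le> 9 \<and>
     (\<forall>d b b' L. frame d b b' L 4 \<longrightarrow> book d b b' L \<inter> B = {} \<longrightarrow> controlled A (book d b b' L) d)"

lemma leaf_in_book:
  assumes F: "frame d b b' L n" and t: "t \<notin> {d, b, b'}" and i: "{d, b, t} \<in> book d b b' L"
  shows "t \<in> L"
proof -
  have "{d, b, t} \<noteq> {d, b, b'}" using triple_inj[of d b b' t] t by auto
  then consider s where "s \<in> L" "{d, b, s} = {d, b, t}" | s where "s \<in> L" "{d, b', s} = {d, b, t}"
    using i by (auto simp: book_def)
  then show ?thesis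
  proof cases
    case 1
    then show ?thesis using triple_inj[of d b s t] t by auto
  next
    case 2
    then show ?thesis using triple_neq[of d b b' t s] F t by (auto simp: frame_def)
  qed
qed

lemma book_in_board:
  assumes "frame d b b' L n" "g \<in> book d b b' L"
  shows "g \<in> board"
  using assms by (auto simp: book_def frame_def intro!: triple_in_board)

text \<open>All edges of \<open>P1\<close> through \<open>d\<close> lie in the book, which he owns
  up to \<open>r\<close>. So the partner of each of his edges at a leaf is either his own or
  \<open>r\<close>.\<close>

lemma settled_rigid:
  assumes F: "frame d b b' L 4" and C: "book d b b' L \<subseteq> insert r (insert e A)"
    and e: "e \<in> book d b b' L" and r: "r \<in> book d b b' L" "r \<notin> insert e A"
    and off: "\<And>g. g \<in> A - book d b b' L \<Longrightarrow> d \<notin> g"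
      "\<And>g h. g \<in> A - book d b b' L \<Longrightarrow> h \<in> A - book d b b' L \<Longrightarrow> g \<noteq> h \<Longrightarrow> meet_once g h"
  shows "rigid (insert e A) (insert r B) d b b'"
proof -
  let ?C = "book d b b' L" and ?A = "insert e A" and ?B = "insert r B"
  have inC: "g \<in> ?C" if "g \<in> ?A" "d \<in> g" for g using that e off(1) by blast
  have bases: "b \<in> g \<or> b' \<in> g" if "g \<in> ?A" "d \<in> g" for g using that inC base_in_book[of _ d b b' L] by blast
  have once: "meet_once g h" if "g \<in> ?A" "h \<in> ?A" "d \<notin> g" "d \<notin> h" "g \<noteq> h" for g h
    using that off(2) center_in_book[of _ d b b' L] e by blast
  have leafs: "t \<in> L" if "t \<notin> {d, b, b'}" "{d, b, t} \<in> ?A \<or> {d, b', t} \<in> ?A" for t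
    using that(2)
  proof
    assume "{d, b, t} \<in> ?A"
    then show ?thesis using inC leaf_in_book[OF F that(1)] by auto
  next
    assume "{d, b', t} \<in> ?A"
    then show ?thesis using inC leaf_in_book[OF frame_swap[OF F], of t] that(1) book_swap[of d b b' L] by auto
  qed
  have partner: "{d, b, t} \<in> ?A \<union> ?B" "{d, b', t} \<in> ?A \<union> ?B" if "t \<in> L" for t
    using that C by (auto simp: book_def)
  \<comment> \<open>Either \<open>r\<close> is the edge \<open>{d, b, b'}\<close>, or it destroys a
    leaf \<open>s\<close> and the other three form \<open>M\<close>.\<close>
  have M: "{d, b, b'} \<in> ?B \<or> (\<exists>M. finite M \<and> card M \<le> 3 \<and>
      (\<forall>t. t \<notin> {d, b, b'} \<and> {d, b, t} \<in> ?A \<and> {d, b', t} \<in> ?A \<longrightarrow> t \<in> M))"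
  proof (cases "r = {d, b, b'}")
    case False
    then obtain s where s: "s \<in> L" "r = {d, b, s} \<or> r = {d, b', s}"
      using r(1) by (auto simp: book_def)
    have "t \<in> L - {s}" if "t \<notin> {d, b, b'} \<and> {d, b, t} \<in> ?A \<and> {d, b', t} \<in> ?A" for t
      using that leafs[of t] s(2) r(2) by (metis Diff_iff singletonD)
    moreover have "finite (L - {s})" "card (L - {s}) \<le> 3" using F s(1) by (auto simp: frame_def)
    ultimately show ?thesis by metis
  qed simp
  have P: "({d, b, t} \<in> ?A \<longrightarrow> {d, b', t} \<in> ?A \<union> ?B) \<and> ({d, b', t} \<in> ?A \<longrightarrow> {d, b, t} \<in> ?A \<union> ?B)"
    if "t \<notin> {d, b, b'}" for t
    using leafs[OF that] partner[of t] by metis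
  have "d \<noteq> b" "d \<noteq> b'" "b \<noteq> b'" using F by (auto simp: frame_def)
  then show ?thesis
    unfolding rigid_def
  proof (intro conjI ballI impI)
    show "{d, b, b'} \<in> ?B \<or> (\<exists>M. finite M \<and> card M \<le> 3 \<and>
      (\<forall>t. t \<notin> {d, b, b'} \<and> {d, b, t} \<in> ?A \<and> {d, b', t} \<in> ?A \<longrightarrow> t \<in> M)) \<and>
      (\<forall>t. t \<notin> {d, b, b'} \<longrightarrow> ({d, b, t} \<in> ?A \<longrightarrow> {d, b', t} \<in> ?A \<union> ?B) \<and>
        ({d, b', t} \<in> ?A \<longrightarrow> {d, b, t} \<in> ?A \<union> ?B))"
      using M by (rule disj_forward) (assumption, erule conjI, intro allI impI P)
  qed (use bases once in blast)+
qed

text \<open>\<open>P1\<close> owns at most seven edges of a live book, so one move completes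
  nothing. If it makes a threat, blocking leads to a rigid position; otherwise ten edges are too few
  for two spines and the chase can start.\<close>

lemma settled_holds:
  assumes pos: "position A B" and core: "has_core B" and st: "settled A B"
  shows "holds A B"
proof (rule holds.reply)
  fix e assume e: "e \<in> board" "e \<notin> A \<union> B"
  have pos': "position (insert e A) B" using pos e by (rule position_move)
  have fin: "finite A" "A \<inter> B = {}" and fin': "finite (insert e A)" "insert e A \<inter> B = {}"
    using pos pos' by (auto simp: position_def)
  have meets: "card (A \<inter> book d b b' L) \<le> 7" if "frame d b b' L 4" "book d b b' L \<inter> B = {}" for d b b' L
    using st that unfolding settled_def controlled_def by fastforce
  have no: "\<not> has_copy (insert e A)"
  proof
    assume "has_copy (insert e A)"
    then obtain d b b' L where C: "frame d b b' L 4" "book d b b' L \<subseteq> insert e A"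
      by (auto simp: has_copy_def)
    have "card (book d b b' L) \<le> card (insert e (A \<inter> book d b b' L))"
      using C(2) fin by (intro card_mono) auto
    also have "\<dots> \<le> Suc (card (A \<inter> book d b b' L))" by (rule card_insert_le_m1) auto
    finally show False using meets[OF C(1)] card_book[OF C(1)] C(2) fin' by fastforce
  qed
  have "\<exists>r\<in>board. r \<notin> insert e A \<union> B \<and> holds (insert e A) (insert r B)"
  proof (cases "\<exists>r. r \<notin> insert e A \<union> B \<and> has_copy (insert r (insert e A))")
    case True
    then obtain r d b b' L where r: "r \<notin> insert e A \<union> B" and F: "frame d b b' L 4"
      and C: "book d b b' L \<subseteq> insert r (insert e A)"
      unfolding has_copy_def by metis
    let ?C = "book d b b' L"
    have B: "?C \<inter> B = {}" using C r fin' by blast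
    have "card ?C \<le> card (({e, r} \<inter> ?C) \<union> (A \<inter> ?C))" using C fin by (intro card_mono) auto
    also have "\<dots> \<le> card ({e, r} \<inter> ?C) + card (A \<inter> ?C)" by (rule card_Un_le)
    finally have le: "9 \<le> card ({e, r} \<inter> ?C) + card (A \<inter> ?C)" using card_book[OF F] by simp
    have le2: "card ({e, r} \<inter> ?C) \<le> 2"
      using card_mono[of "{e, r}" "{e, r} \<inter> ?C"] by (auto simp: card_insert_if split: if_splits)
    \<comment> \<open>Nine edges with at most seven owned before: both \<open>e\<close> and
      \<open>r\<close> lie in the book and exactly seven were owned, which is the second case of
      \<open>controlled\<close>.\<close>
    have "card ({e, r} \<inter> ?C) \<ge> 2" "\<not> card (A \<inter> ?C) \<le> 6"
      using le le2 meets[OF F B] by auto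
    then have "{e, r} \<inter> ?C = {e, r}"
      by (intro card_seteq) (auto simp: card_insert_if)
    then have er: "e \<in> ?C" "r \<in> ?C" by auto
    have off: "\<And>g. g \<in> A - ?C \<Longrightarrow> d \<notin> g" "\<And>g h. g \<in> A - ?C \<Longrightarrow> h \<in> A - ?C \<Longrightarrow> g \<noteq> h \<Longrightarrow> meet_once g h"
      using st F B \<open>\<not> card (A \<inter> ?C) \<le> 6\<close> unfolding settled_def controlled_def by blast+
    have rb: "r \<in> board" using F er(2) by (rule book_in_board)
    have "rigid (insert e A) (insert r B) d b b'"
      using settled_rigid[OF F C er _ off] r by blast
    moreover have "has_core (insert r B)" using core unfolding has_core_def by blast
    ultimately have "holds (insert e A) (insert r B)"
      using rigid_holds position_reply[OF pos' rb r] by blast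
    then show ?thesis using rb r by blast
  next
    case False
    have safe: "\<not> has_copy (insert r (insert e A))" if "r \<notin> B" for r
      using False no that by (cases "r \<in> insert e A") (auto simp: insert_absorb)
    obtain c x y L where K: "frame c x y L 3" "book c x y L \<subseteq> B"
      using core by (auto simp: has_core_def)
    have "card (insert e A) \<le> 10"
      using st card_insert_le_m1[of 10 A e] by (simp add: settled_def)
    then have "\<not> (has_spine (insert e A) c x \<and> has_spine (insert e A) c y)"
      using spines_card[OF fin', of c x y] K by (auto simp: frame_def book_def)
    then show ?thesis using start_chase[OF pos' K safe] by blast
  qed
  then show "\<not> has_copy (insert e A) \<and> (\<exists>r\<in>board. r \<notin> insert e A \<union> B \<and> holds (insert e A) (insert r B))"
    using no by blast
qed

section \<open>Counting the wasted edges of \<open>P1\<close>\<close>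

text \<open>If \<open>g\<close> and \<open>h\<close> are the only edges outside \<open>C\<close>, at
  most seven lie in \<open>C\<close> and the second case of \<open>controlled\<close> is available;
  a third edge outside leaves at most six.\<close>

lemma controlled_two:
  assumes "finite A" "card A \<le> 9" "g \<in> A - C" "h \<in> A - C" "g \<noteq> h" "d \<notin> g" "d \<notin> h" "meet_once g h"
  shows "controlled A C d"
proof (cases "A - C = {g, h}")
  case True
  have "card (A \<inter> C) + card (A - C) = card A" using assms(1) by (rule card_Int_Diff[symmetric])
  then have "card (A \<inter> C) \<le> 7" using True assms by simp
  then show ?thesis using True assms by (auto simp: controlled_def meet_once_def)
next
  case False
  then have "{g, h} \<subset> A - C" using assms by auto
  then have "card {g, h} < card (A - C)" using assms by (intro psubset_card_mono) auto
  then show ?thesis using assms card_Int_Diff[of A C] by (auto simp: controlled_def)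
qed

lemma controlled_three:
  assumes "finite A" "card A \<le> 9" "{f, g, h} \<subseteq> A - C" "f \<noteq> g" "f \<noteq> h" "g \<noteq> h"
  shows "controlled A C d"
  using card_mono[OF _ assms(3)] assms card_Int_Diff[of A C] by (simp add: controlled_def)

lemma settled_seven:
  assumes "finite A" "card A \<le> 7"
  shows "settled A B"
proof -
  have "controlled A C d" for C d
  proof (cases "A - C = {}")
    case True
    then show ?thesis using assms card_mono[of A "A \<inter> C"] by (auto simp: controlled_def)
  next
    case False
    then have "card (A - C) > 0" using assms by (simp add: card_gt_0_iff)
    then show ?thesis using assms card_Int_Diff[of A C] by (simp add: controlled_def)
  qed
  then show ?thesis using assms by (simp add: settled_def)
qed

text \<open>Disjoint edges have no common center, so one of \<open>f\<close>, \<open>g\<close> lies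
  outside the book. If nothing else does, the other one contains the center, and hence the outer one
  avoids it.\<close>

lemma settled_eight:
  assumes "finite A" "card A \<le> 8" "f \<in> A" "g \<in> A" "f \<inter> g = {}"
  shows "settled A B"
proof -
  have *: "controlled A (book d b b' L) d" if "f \<in> A" "g \<in> A" "f \<inter> g = {}" "f \<notin> book d b b' L" for d b b' L f g
  proof (cases "A - book d b b' L = {f}")
    case True
    have "card (A \<inter> book d b b' L) + card (A - book d b b' L) = card A"
      using assms(1) by (rule card_Int_Diff[symmetric])
    then have "card (A \<inter> book d b b' L) \<le> 7" using True assms by simp
    moreover have "d \<notin> f"
    proof
      assume "d \<in> f"
      then have "d \<notin> g" "g \<noteq> f" using that by auto
      then show False using True that center_in_book[of g d b b' L] by blast
    qed
    ultimately show ?thesis using True by (auto simp: controlled_def)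
  next
    case False
    then have "{f} \<subset> A - book d b b' L" using that by auto
    then have "card {f} < card (A - book d b b' L)" using assms by (intro psubset_card_mono) auto
    then show ?thesis using assms card_Int_Diff[of A "book d b b' L"] by (auto simp: controlled_def)
  qed
  have "controlled A (book d b b' L) d" for d b b' L
  proof (cases "f \<in> book d b b' L")
    case True
    then have "g \<notin> book d b b' L"
      using center_in_book[OF True] center_in_book[of g d b b' L] assms(5) by auto
    moreover have "g \<inter> f = {}" using assms(5) by (simp add: Int_commute)
    ultimately show ?thesis using * assms(3,4) by metis
  next
    case False
    then show ?thesis by (rule *[OF assms(3-5)])
  qed
  then show ?thesis using assms by (simp add: settled_def)
qed

text \<open>What keeps copies centered at the center \<open>c\<close> of \<open>P2\<close> harmless: besides \<open>f\<close> there is a further edge avoiding \<open>c\<close>,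
  and either these two meet at most once or a third edge is wasted as well. An edge \<open>h\<close> through both \<open>c\<close> and \<open>x\<close> counts as
  wasted, because no live copy contains it together with a block.\<close>

definition reserve :: "'a set set \<Rightarrow> 'a set \<Rightarrow> 'a \<Rightarrow> 'a \<Rightarrow> bool" where
  "reserve A f c x \<longleftrightarrow> (\<exists>g \<in> A. g \<noteq> f \<and> c \<notin> g \<and>
     (meet_once f g \<or> (\<exists>h \<in> A. h \<noteq> f \<and> h \<noteq> g \<and> (c \<in> h \<longrightarrow> x \<in> h))))"

lemma reserve_insert: "reserve A f c x \<Longrightarrow> reserve (insert e A) f c x"
  unfolding reserve_def by blast

text \<open>In the link of \<open>c\<close>, one end of the edge joining \<open>z\<close> and
  \<open>p\<close> is a base, and a base is adjacent to every other vertex of the book.\<close>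

lemma base_adjacent:
  assumes F: "frame c b b' L n" and g: "{c, z, p} \<in> book c b b' L" "distinct [c, z, p]"
    and h: "h \<in> book c b b' L" "x \<in> h" "x \<notin> {c, z, p}"
  shows "{c, x, z} \<in> book c b b' L \<or> {c, x, p} \<in> book c b b' L"
proof -
  have adj: "{c, s, t} \<in> book c b b' L" if "s \<in> {b, b'}" "t \<in> {b, b'} \<union> L" "s \<noteq> t" for s t
    using that by (auto simp: book_def insert_commute)
  have xV: "x \<in> {b, b'} \<union> L" using h F by (auto simp: book_def)
  have "z \<in> {b, b'} \<or> p \<in> {b, b'}" using base_in_book[OF g(1)] F by (auto simp: frame_def)
  then show ?thesis
    using adj[of z x] adj[of p x] xV h(3) by (auto simp: insert_commute)
qed

text \<open>The edge \<open>f\<close> is disjoint from the blocks \<open>{c, z, p}\<close> and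
  \<open>{c, y, q}\<close>, which meet only in \<open>c\<close>. So for a live book with center
  \<open>u\<close> other than \<open>c\<close>, these three edges contain either two wasted ones
  avoiding \<open>u\<close> or three wasted ones. For \<open>u = c\<close> both blocks may be
  useful, and \<open>reserve\<close> takes their place.\<close>

lemma settled_nine:
  assumes fin: "finite A" "card A \<le> 9" and A: "f \<in> A" "{c, z, p} \<in> A" "{c, y, q} \<in> A"
    and d: "distinct [c, x, y, z, p, q]" and f: "f \<inter> {c, y, z, p, q} = {}"
    and B: "{c, x, y} \<in> B" "{c, x, z} \<in> B" "{c, x, p} \<in> B" "{c, x, q} \<in> B"
    and res: "reserve A f c x"
  shows "settled A B"
proof -
  let ?g = "{c, z, p}" and ?h = "{c, y, q}"
  have gh: "?g \<noteq> ?h" "f \<noteq> ?g" "f \<noteq> ?h" using d f by auto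
  have m: "meet_once ?g ?h" "meet_once f ?g" "meet_once f ?h" using d f by (auto simp: meet_once_def)
  have "controlled A (book u b b' L) u"
    if F: "frame u b b' L 4" and live: "book u b b' L \<inter> B = {}" for u b b' L
  proof -
    let ?C = "book u b b' L"
    have ctr: "e \<in> ?C \<Longrightarrow> u \<in> e" for e by (rule center_in_book)
    show ?thesis
    proof (cases "f \<in> ?C")
      case True
      then have "u \<notin> ?g" "u \<notin> ?h" using ctr[of f] f by auto
      then show ?thesis using ctr A gh m fin by (intro controlled_two[of A ?g _ ?h]) blast+
    next
      case fC: False
      show ?thesis
      proof (cases "u = c")
        case True
        have cf: "c \<notin> f" using f by auto
        obtain g where g: "g \<in> A" "g \<noteq> f" "c \<notin> g"
          "meet_once f g \<or> (\<exists>h \<in> A. h \<noteq> f \<and> h \<noteq> g \<and> (c \<in> h \<longrightarrow> x \<in> h))"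
          using res unfolding reserve_def by blast
        have gC: "g \<notin> ?C" using ctr[of g] g True by auto
        from g(4) show ?thesis
        proof
          assume "meet_once f g"
          then show ?thesis using g fC gC A fin cf True by (intro controlled_two[of A f _ g]) auto
        next
          assume "\<exists>h \<in> A. h \<noteq> f \<and> h \<noteq> g \<and> (c \<in> h \<longrightarrow> x \<in> h)"
          then obtain h where h: "h \<in> A" "h \<noteq> f" "h \<noteq> g" "c \<in> h \<longrightarrow> x \<in> h" by blast
          show ?thesis
          proof (cases "h \<in> ?C")
            case False
            then show ?thesis using g h fC gC A fin by (intro controlled_three[of A f g h]) auto
          next
            \<comment> \<open>Here \<open>h\<close> contains \<open>c\<close> and \<open>x\<close>,
              and \<open>P2\<close> owns \<open>{c, x, z}\<close> and \<open>{c, x, p}\<close>. So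
              \<open>{c, z, p}\<close> cannot share a live book with \<open>h\<close> and is the
              third wasted edge.\<close>
            case hC: True
            then have xh: "x \<in> h" using h(4) ctr[of h] True by auto
            have "?g \<notin> ?C"
            proof
              assume "?g \<in> ?C"
              then have "{c, x, z} \<in> ?C \<or> {c, x, p} \<in> ?C"
                using base_adjacent[of c b b' L 4 z p h x] F True hC xh d by auto
              then show False using live B by blast
            qed
            moreover have "?g \<noteq> g" using g(3) by auto
            ultimately show ?thesis using g fC gC A fin gh by (intro controlled_three[of A f g ?g]) auto
          qed
        qed
      next
        case uc: False
        show ?thesis
        proof (cases "?g \<in> ?C")
          case True
          then have "u \<in> {z, p}" using ctr[of ?g] uc by auto
          then have "u \<notin> ?h" "u \<notin> f" using d f by auto
          then show ?thesis using ctr[of ?h] fC A gh m fin by (intro controlled_two[of A f _ ?h]) auto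
        next
          case gC: False
          show ?thesis
          proof (cases "?h \<in> ?C")
            case True
            then have "u \<in> {y, q}" using ctr[of ?h] uc by auto
            then have "u \<notin> ?g" "u \<notin> f" using d f by auto
            then show ?thesis using fC gC A gh m fin by (intro controlled_two[of A f _ ?g]) auto
          next
            case False
            then show ?thesis using fC gC A gh fin by (intro controlled_three[of A f ?g ?h]) auto
          qed
        qed
      qed
    qed
  qed
  then show ?thesis using fin by (simp add: settled_def)
qed

section \<open>The opening of \<open>P2\<close>\<close>

lemma holdsI:
  assumes "position A B"
    and "\<And>e. e \<in> board \<Longrightarrow> e \<notin> A \<union> B \<Longrightarrow> position (insert e A) B \<Longrightarrow> \<not> has_copy (insert e A) \<and>
      (\<exists>r \<in> board. r \<notin> insert e A \<union> B \<and>
        (position (insert e A) (insert r B) \<longrightarrow> holds (insert e A) (insert r B)))"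
  shows "holds A B"
proof (rule holds.reply)
  fix e assume e: "e \<in> board" "e \<notin> A \<union> B"
  have p: "position (insert e A) B" using assms(1) e by (rule position_move)
  from assms(2)[OF e p] obtain r where "\<not> has_copy (insert e A)" "r \<in> board" "r \<notin> insert e A \<union> B"
    "position (insert e A) (insert r B) \<longrightarrow> holds (insert e A) (insert r B)" by metis
  with position_reply[OF p] show "\<not> has_copy (insert e A) \<and>
      (\<exists>r \<in> board. r \<notin> insert e A \<union> B \<and> holds (insert e A) (insert r B))" by metis
qed

lemma has_coreI:
  assumes "distinct [c, u, v, a, b, d]"
    and "{{c, u, v}, {c, u, a}, {c, u, b}, {c, u, d}, {c, v, a}, {c, v, b}, {c, v, d}} \<subseteq> B"
  shows "has_core B"
proof -
  have "frame c u v {a, b, d} 3" using assms(1) by (auto simp: frame_def)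
  moreover have "book c u v {a, b, d} \<subseteq> B" using assms(2) by (auto simp: book_def)
  ultimately show ?thesis unfolding has_core_def by metis
qed

lemma card_insert_bound: "card A \<le> n \<Longrightarrow> card (insert e A) \<le> Suc n"
  by (rule card_insert_le_m1) auto

text \<open>The opening in reverse order of play. In the link of \<open>c\<close>, \<open>P2\<close> builds a triangle \<open>x y z\<close>, then \<open>p\<close> joined to \<open>x\<close> and
  \<open>y\<close>, then a pendant edge \<open>x q\<close>; each of these graphs leaves more ways to a core than \<open>P1\<close> can block.\<close>

lemma holds_two_open_leaves:
  assumes pos: "position A B" and A: "card A \<le> 8" "f \<in> A" "{c, z, p} \<in> A" "{c, y, q} \<in> A"
    and d: "distinct [c, x, y, z, p, q, r]" and f: "f \<inter> {c, y, z, p, q} = {}"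
    and B: "{{c, x, y}, {c, x, z}, {c, y, z}, {c, x, p}, {c, y, p}, {c, x, q}, {c, z, q}, {c, x, r}} \<subseteq> B"
    and r: "{c, y, r} \<notin> A \<union> B" "{c, z, r} \<notin> A \<union> B" and res: "reserve A f c x"
  shows "holds A B"
proof (rule holdsI[OF pos])
  fix e assume e: "e \<in> board" "e \<notin> A \<union> B" and pos': "position (insert e A) B"
  have fin: "finite (insert e A)" "card (insert e A) \<le> 9"
    using pos' card_insert_bound[OF A(1)] by (auto simp: position_def)
  have st: "settled (insert e A) (insert s B)" for s
    using A d f B by (intro settled_nine[OF fin, of f c z p y q x] reserve_insert[OF res]) auto
  \<comment> \<open>With nine edges, counting alone no longer excludes a copy; \<open>f\<close> and
    the disjoint block \<open>{c, z, p}\<close> do.\<close>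
  have "\<not> has_copy (insert e A)"
    using A f by (intro not_has_copy_disjoint[OF fin, of f "{c, z, p}"]) auto
  \<comment> \<open>The vertex \<open>r\<close> completes a core with bases \<open>x\<close>,
    \<open>y\<close> and leaves \<open>z\<close>, \<open>p\<close>, \<open>r\<close>, or one with
    bases \<open>x\<close>, \<open>z\<close> and leaves \<open>y\<close>, \<open>q\<close>,
    \<open>r\<close>; \<open>P1\<close> can stop only one.\<close>
  moreover have "\<exists>s\<in>board. s \<notin> insert e A \<union> B \<and> has_core (insert s B)"
  proof (cases "e = {c, y, r}")
    case False
    have "has_core (insert {c, y, r} B)"
      using d B by (intro has_coreI[of c x y z p r]) auto
    moreover have "{c, y, r} \<notin> insert e A \<union> B" using False r by simp
    moreover have "{c, y, r} \<in> board" using d by (intro triple_in_board) auto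
    ultimately show ?thesis by metis
  next
    case True
    have "{c, z, r} \<noteq> {c, y, r}" using d by auto
    then have "{c, z, r} \<notin> insert e A \<union> B" using True r by simp
    moreover have "{c, z, y} \<in> B" using B by (simp add: insert_commute)
    then have "has_core (insert {c, z, r} B)"
      using d B by (intro has_coreI[of c x z y q r]) auto
    moreover have "{c, z, r} \<in> board" using d by (intro triple_in_board) auto
    ultimately show ?thesis by metis
  qed
  ultimately show "\<not> has_copy (insert e A) \<and> (\<exists>r \<in> board. r \<notin> insert e A \<union> B \<and>
        (position (insert e A) (insert r B) \<longrightarrow> holds (insert e A) (insert r B)))"
    using settled_holds[OF _ _ st] by metis
qed

text \<open>The bases \<open>x\<close>, \<open>y\<close> have the leaves \<open>z\<close>,
  \<open>p\<close>, and the bases \<open>x\<close>, \<open>z\<close> have the leaves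
  \<open>y\<close>, \<open>q\<close>. A fresh \<open>n\<close> joined to \<open>x\<close> can become
  the third leaf of either pair.\<close>

lemma holds_blocked_twice:
  assumes pos: "position A B" and A: "card A \<le> 7" "f \<in> A" "{c, z, p} \<in> A" "{c, y, q} \<in> A"
    and d: "distinct [c, x, y, z, p, q]" and f: "f \<inter> {c, y, z, p, q} = {}"
    and B: "{{c, x, y}, {c, x, z}, {c, y, z}, {c, x, p}, {c, y, p}, {c, x, q}, {c, z, q}} \<subseteq> B"
    and res: "reserve A f c x"
  shows "holds A B"
proof (rule holdsI[OF pos])
  fix e assume e: "e \<in> board" "e \<notin> A \<union> B" and pos': "position (insert e A) B"
  have fin: "finite (insert e A)" "card (insert e A) \<le> 8"
    using pos' card_insert_bound[OF A(1)] by (auto simp: position_def)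
  obtain n where n: "n \<notin> \<Union>(insert e A)" "n \<notin> \<Union>B" "n \<notin> {c, x, y, z, p, q}"
    by (rule fresh_vertex[OF pos', of "{c, x, y, z, p, q}"]) auto
  have fresh: "g \<notin> insert e A \<union> B" if "n \<in> g" for g using n that by blast
  have "{c, x, n} \<in> board" using d n by (intro triple_in_board) auto
  moreover have "{c, y, n} \<noteq> {c, x, n}" "{c, z, n} \<noteq> {c, x, n}" using d n(3) by auto
  then have "{c, y, n} \<notin> insert e A \<union> insert {c, x, n} B" "{c, z, n} \<notin> insert e A \<union> insert {c, x, n} B"
    using fresh[of "{c, y, n}"] fresh[of "{c, z, n}"] by auto
  then have "holds (insert e A) (insert {c, x, n} B)" if "position (insert e A) (insert {c, x, n} B)"
    using that A d f B n(3) fin(2) reserve_insert[OF res]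
    by (intro holds_two_open_leaves[of _ _ f c z p y q x n]) auto
  moreover have "\<not> has_copy (insert e A)" using fin by (intro not_has_copy_card_less) auto
  ultimately show "\<not> has_copy (insert e A) \<and> (\<exists>r \<in> board. r \<notin> insert e A \<union> B \<and>
        (position (insert e A) (insert r B) \<longrightarrow> holds (insert e A) (insert r B)))"
    using fresh[of "{c, x, n}"] by (metis insertCI)
qed

text \<open>In the link of \<open>c\<close> the vertices \<open>x\<close>, \<open>y\<close>,
  \<open>z\<close>, \<open>p\<close> are pairwise joined, so joining \<open>q\<close> to
  \<open>z\<close> or to \<open>p\<close> completes a core with that vertex and \<open>x\<close> as
  bases. \<open>P1\<close> cannot prevent both.\<close>

lemma holds_K4_pendant:
  assumes pos: "position A B" and A: "card A \<le> 7" "f \<in> A" "{c, y, q} \<in> A"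
    and d: "distinct [c, x, y, z, p, q]" and f: "f \<inter> {c, y, q} = {}"
    and B: "{{c, x, y}, {c, x, z}, {c, y, z}, {c, x, p}, {c, y, p}, {c, z, p}, {c, x, q}} \<subseteq> B"
    and q: "{c, z, q} \<notin> A \<union> B" "{c, p, q} \<notin> A \<union> B"
  shows "holds A B"
proof (rule holdsI[OF pos])
  fix e assume e: "e \<in> board" "e \<notin> A \<union> B" and pos': "position (insert e A) B"
  have fin: "finite (insert e A)" "card (insert e A) \<le> 8"
    using pos' card_insert_bound[OF A(1)] by (auto simp: position_def)
  have st: "settled (insert e A) (insert s B)" for s
    using A f by (intro settled_eight[OF fin, of f "{c, y, q}"]) auto
  have sw: "{c, z, y} \<in> B" "{c, p, y} \<in> B" "{c, p, z} \<in> B" using B by (auto simp: insert_commute)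
  have "\<not> has_copy (insert e A)" using fin by (intro not_has_copy_card_less) auto
  moreover have "\<exists>s\<in>board. s \<notin> insert e A \<union> B \<and> has_core (insert s B)"
  proof (cases "e = {c, z, q}")
    case False
    have "has_core (insert {c, z, q} B)"
      using d B sw by (intro has_coreI[of c x z y p q]) auto
    moreover have "{c, z, q} \<notin> insert e A \<union> B" using False q by simp
    moreover have "{c, z, q} \<in> board" using d by (intro triple_in_board) auto
    ultimately show ?thesis by metis
  next
    case True
    have "{c, p, q} \<noteq> {c, z, q}" using d by auto
    then have "{c, p, q} \<notin> insert e A \<union> B" using True q by simp
    moreover have "has_core (insert {c, p, q} B)"
      using d B sw by (intro has_coreI[of c x p y z q]) auto
    moreover have "{c, p, q} \<in> board" using d by (intro triple_in_board) auto
    ultimately show ?thesis by metis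
  qed
  ultimately show "\<not> has_copy (insert e A) \<and> (\<exists>r \<in> board. r \<notin> insert e A \<union> B \<and>
        (position (insert e A) (insert r B) \<longrightarrow> holds (insert e A) (insert r B)))"
    using settled_holds[OF _ _ st] by metis
qed

text \<open>The threat is \<open>{c, y, q}\<close>, giving a core with bases \<open>x\<close>,
  \<open>y\<close>. Once it is blocked, \<open>P2\<close> takes \<open>{c, z, p}\<close> if it is
  free; otherwise that edge is a second block disjoint from \<open>f\<close>, and
  \<open>{c, z, q}\<close> prepares \<open>z\<close> as an alternative base.\<close>

lemma holds_diamond_pendant:
  assumes pos: "position A B" and A: "card A \<le> 6" "f \<in> A"
    and d: "distinct [c, x, y, z, p, q]" and f: "f \<inter> {c, y, z, p, q} = {}"
    and B: "{{c, x, y}, {c, x, z}, {c, y, z}, {c, x, p}, {c, y, p}, {c, x, q}} \<subseteq> B" "{c, z, p} \<notin> B"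
    and q: "{c, y, q} \<notin> A \<union> B" "{c, z, q} \<notin> A \<union> B" "{c, p, q} \<notin> A \<union> B" and res: "reserve A f c x"
  shows "holds A B"
proof (rule holdsI[OF pos])
  fix e assume e: "e \<in> board" "e \<notin> A \<union> B" and pos': "position (insert e A) B"
  have fin: "finite (insert e A)" "card (insert e A) \<le> 7"
    using pos' card_insert_bound[OF A(1)] by (auto simp: position_def)
  have "\<not> has_copy (insert e A)" using fin by (intro not_has_copy_card_less) auto
  moreover have "\<exists>r \<in> board. r \<notin> insert e A \<union> B \<and>
        (position (insert e A) (insert r B) \<longrightarrow> holds (insert e A) (insert r B))"
  proof (cases "e = {c, y, q}")
    case False
    have "has_core (insert {c, y, q} B)"
      using d B by (intro has_coreI[of c x y z p q]) auto
    then have "position (insert e A) (insert {c, y, q} B) \<longrightarrow> holds (insert e A) (insert {c, y, q} B)"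
      using settled_holds[OF _ _ settled_seven[OF fin]] by metis
    moreover have "{c, y, q} \<notin> insert e A \<union> B" using False q by simp
    moreover have "{c, y, q} \<in> board" using d by (intro triple_in_board) auto
    ultimately show ?thesis by metis
  next
    case e: True
    have ne: "{c, z, q} \<noteq> {c, y, q}" "{c, p, q} \<noteq> {c, y, q}" "{c, z, q} \<noteq> {c, z, p}" "{c, p, q} \<noteq> {c, z, p}"
      "{c, z, p} \<noteq> {c, y, q}"
      using d by auto
    show ?thesis
    proof (cases "{c, z, p} \<in> A")
      case False
      have "{c, z, q} \<notin> insert e A \<union> insert {c, z, p} B" "{c, p, q} \<notin> insert e A \<union> insert {c, z, p} B"
        using q ne e by simp_all
      then have "holds (insert e A) (insert {c, z, p} B)" if "position (insert e A) (insert {c, z, p} B)"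
        using that A d f B fin(2) e by (intro holds_K4_pendant[of _ _ f c y q x z p]) auto
      moreover have "{c, z, p} \<notin> insert e A \<union> B" using False B(2) ne e by simp
      moreover have "{c, z, p} \<in> board" using d by (intro triple_in_board) auto
      ultimately show ?thesis by metis
    next
      case True
      then have "holds (insert e A) (insert {c, z, q} B)" if "position (insert e A) (insert {c, z, q} B)"
        using that A d f B fin(2) e reserve_insert[OF res] by (intro holds_blocked_twice[of _ _ f c z p y q x]) auto
      moreover have "{c, z, q} \<notin> insert e A \<union> B" using q ne e by simp
      moreover have "{c, z, q} \<in> board" using d by (intro triple_in_board) auto
      ultimately show ?thesis by metis
    qed
  qed
  ultimately show "\<not> has_copy (insert e A) \<and> (\<exists>r \<in> board. r \<notin> insert e A \<union> B \<and>
        (position (insert e A) (insert r B) \<longrightarrow> holds (insert e A) (insert r B)))" by metis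
qed

text \<open>A fresh vertex joined to \<open>x\<close> leaves open its edges to \<open>y\<close>,
  \<open>z\<close> and \<open>p\<close>.\<close>

lemma holds_diamond:
  assumes pos: "position A B" and A: "card A \<le> 5" "f \<in> A"
    and d: "distinct [c, x, y, z, p]" and f: "f \<inter> {c, y, z, p} = {}"
    and B: "{{c, x, y}, {c, x, z}, {c, y, z}, {c, x, p}, {c, y, p}} \<subseteq> B" "{c, z, p} \<notin> B"
    and res: "reserve A f c x"
  shows "holds A B"
proof (rule holdsI[OF pos])
  fix e assume e: "e \<in> board" "e \<notin> A \<union> B" and pos': "position (insert e A) B"
  have fin: "finite (insert e A)" "card (insert e A) \<le> 6"
    using pos' card_insert_bound[OF A(1)] by (auto simp: position_def)
  obtain n where n: "n \<notin> \<Union>(insert e A)" "n \<notin> \<Union>B" "n \<notin> {c, x, y, z, p}"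
    by (rule fresh_vertex[OF pos', of "{c, x, y, z, p}"]) auto
  have fresh: "g \<notin> insert e A \<union> B" if "n \<in> g" for g using n that by blast
  have "n \<notin> f" using n(1) A(2) by auto
  have "{c, x, n} \<in> board" using d n by (intro triple_in_board) auto
  moreover have "{c, y, n} \<noteq> {c, x, n}" "{c, z, n} \<noteq> {c, x, n}" "{c, p, n} \<noteq> {c, x, n}" "{c, z, p} \<noteq> {c, x, n}"
    using d n(3) by auto
  then have "{c, y, n} \<notin> insert e A \<union> insert {c, x, n} B" "{c, z, n} \<notin> insert e A \<union> insert {c, x, n} B"
    "{c, p, n} \<notin> insert e A \<union> insert {c, x, n} B" "{c, z, p} \<notin> insert {c, x, n} B"
    using fresh[of "{c, y, n}"] fresh[of "{c, z, n}"] fresh[of "{c, p, n}"] B(2) by simp_all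
  then have "holds (insert e A) (insert {c, x, n} B)" if "position (insert e A) (insert {c, x, n} B)"
    using that A d f B n(3) fin(2) \<open>n \<notin> f\<close> reserve_insert[OF res]
    by (intro holds_diamond_pendant[of _ _ f c x y z p n]) auto
  moreover have "\<not> has_copy (insert e A)" using fin by (intro not_has_copy_card_less) auto
  ultimately show "\<not> has_copy (insert e A) \<and> (\<exists>r \<in> board. r \<notin> insert e A \<union> B \<and>
        (position (insert e A) (insert r B) \<longrightarrow> holds (insert e A) (insert r B)))"
    using fresh[of "{c, x, n}"] by (metis insertCI)
qed

text \<open>In the triangle \<open>y\<close> and \<open>z\<close> are interchangeable, so a block at
  \<open>{c, y, p}\<close> is answered by \<open>{c, z, p}\<close> with their roles swapped.\<close>

lemma holds_triangle_pendant:
  assumes pos: "position A B" and A: "card A \<le> 4" "f \<in> A"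
    and d: "distinct [c, x, y, z, p]" and f: "f \<inter> {c, y, z, p} = {}"
    and B: "{{c, x, y}, {c, x, z}, {c, y, z}, {c, x, p}} \<subseteq> B"
    and p: "{c, y, p} \<notin> A \<union> B" "{c, z, p} \<notin> A \<union> B"
    and res: "reserve A f c x"
  shows "holds A B"
proof (rule holdsI[OF pos])
  fix e assume e: "e \<in> board" "e \<notin> A \<union> B" and pos': "position (insert e A) B"
  have fin: "finite (insert e A)" "card (insert e A) \<le> 5"
    using pos' card_insert_bound[OF A(1)] by (auto simp: position_def)
  have ne: "{c, z, p} \<noteq> {c, y, p}" using d by auto
  have "\<not> has_copy (insert e A)" using fin by (intro not_has_copy_card_less) auto
  moreover have "\<exists>r \<in> board. r \<notin> insert e A \<union> B \<and>
        (position (insert e A) (insert r B) \<longrightarrow> holds (insert e A) (insert r B))"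
  proof (cases "e = {c, y, p}")
    case False
    have "{c, z, p} \<notin> insert {c, y, p} B" using ne p by simp
    then have "holds (insert e A) (insert {c, y, p} B)" if "position (insert e A) (insert {c, y, p} B)"
      using that A d f B fin(2) reserve_insert[OF res] by (intro holds_diamond[of _ _ f c x y z p]) auto
    moreover have "{c, y, p} \<notin> insert e A \<union> B" using False p by simp
    moreover have "{c, y, p} \<in> board" using d by (intro triple_in_board) auto
    ultimately show ?thesis by metis
  next
    case True
    have "{c, z, y} \<in> B" using B by (simp add: insert_commute)
    moreover have "{c, y, p} \<notin> insert {c, z, p} B" using ne p by simp
    ultimately have "holds (insert e A) (insert {c, z, p} B)" if "position (insert e A) (insert {c, z, p} B)"
      using that A d f B fin(2) reserve_insert[OF res] by (intro holds_diamond[of _ _ f c x z y p]) auto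
    moreover have "{c, z, p} \<notin> insert e A \<union> B" using True p ne by simp
    moreover have "{c, z, p} \<in> board" using d by (intro triple_in_board) auto
    ultimately show ?thesis by metis
  qed
  ultimately show "\<not> has_copy (insert e A) \<and> (\<exists>r \<in> board. r \<notin> insert e A \<union> B \<and>
        (position (insert e A) (insert r B) \<longrightarrow> holds (insert e A) (insert r B)))" by metis
qed

lemma holds_triangle:
  assumes pos: "position A B" and A: "card A \<le> 3" "f \<in> A"
    and d: "distinct [c, x, y, z]" and f: "f \<inter> {c, y, z} = {}"
    and B: "{{c, x, y}, {c, x, z}, {c, y, z}} \<subseteq> B"
    and res: "reserve A f c x"
  shows "holds A B"
proof (rule holdsI[OF pos])
  fix e assume e: "e \<in> board" "e \<notin> A \<union> B" and pos': "position (insert e A) B"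
  have fin: "finite (insert e A)" "card (insert e A) \<le> 4"
    using pos' card_insert_bound[OF A(1)] by (auto simp: position_def)
  obtain n where n: "n \<notin> \<Union>(insert e A)" "n \<notin> \<Union>B" "n \<notin> {c, x, y, z}"
    by (rule fresh_vertex[OF pos', of "{c, x, y, z}"]) auto
  have fresh: "g \<notin> insert e A \<union> B" if "n \<in> g" for g using n that by blast
  have "n \<notin> f" using n(1) A(2) by auto
  have "{c, x, n} \<in> board" using d n by (intro triple_in_board) auto
  moreover have "{c, y, n} \<noteq> {c, x, n}" "{c, z, n} \<noteq> {c, x, n}"
    using d n(3) by auto
  then have "{c, y, n} \<notin> insert e A \<union> insert {c, x, n} B" "{c, z, n} \<notin> insert e A \<union> insert {c, x, n} B"
    using fresh[of "{c, y, n}"] fresh[of "{c, z, n}"] by simp_all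
  then have "holds (insert e A) (insert {c, x, n} B)" if "position (insert e A) (insert {c, x, n} B)"
    using that A d f B n(3) fin(2) \<open>n \<notin> f\<close> reserve_insert[OF res]
    by (intro holds_triangle_pendant[of _ _ f c x y z n]) auto
  moreover have "\<not> has_copy (insert e A)" using fin by (intro not_has_copy_card_less) auto
  ultimately show "\<not> has_copy (insert e A) \<and> (\<exists>r \<in> board. r \<notin> insert e A \<union> B \<and>
        (position (insert e A) (insert r B) \<longrightarrow> holds (insert e A) (insert r B)))"
    using fresh[of "{c, x, n}"] by (metis insertCI)
qed

text \<open>Both \<open>c\<close> and \<open>u\<close> can still become the center \<open>w\<close>,
  the other one playing \<open>x\<close>, since \<open>{w, y, z}\<close> closes a triangle in either
  link. The third edge of \<open>P1\<close> decides: \<open>{w, y, z}\<close> must be free and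
  \<open>reserve\<close> must hold.\<close>

lemma holds_two_petals:
  assumes pos: "position {f, g} B" and d: "distinct [c, u, y, z]" and f: "f \<inter> {c, u, y, z} = {}"
    and B: "B = {{c, u, y}, {c, u, z}}" and g: "f \<noteq> g" "c \<notin> g" "z \<notin> g" "meet_once f g \<or> u \<notin> g"
  shows "holds {f, g} B"
proof (rule holdsI[OF pos])
  fix e assume e: "e \<in> board" "e \<notin> {f, g} \<union> B" and pos': "position (insert e {f, g}) B"
  let ?A = "insert e {f, g}"
  have fin: "finite ?A" "card ?A \<le> 3" by (auto simp: card_insert_if)
  have ex: "\<exists>w x. {w, x} = {c, u} \<and> w \<noteq> x \<and> e \<noteq> {w, y, z} \<and> reserve ?A f w x"
  proof -
    have m: "meet_once f {w, y, z}" if "w \<in> {c, u}" for w using f that by (auto simp: meet_once_def)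
    \<comment> \<open>First case: center \<open>u\<close>, with \<open>e\<close> itself as the
      wasted edge. Second: center \<open>c\<close>, with \<open>g\<close> wasted and
      \<open>e\<close> as third edge if \<open>f\<close> and \<open>g\<close> share two vertices.
      Third: center \<open>u\<close>, which neither \<open>g\<close> nor \<open>e\<close>
      contains.\<close>
    consider "e = {c, y, z}" | "e \<noteq> {c, y, z}" "meet_once f g \<or> c \<notin> e \<or> u \<in> e"
      | "e \<noteq> {c, y, z}" "\<not> meet_once f g" "c \<in> e" "u \<notin> e" by blast
    then show ?thesis
    proof cases
      case 1
      then have "u \<notin> e" "e \<noteq> f" "e \<noteq> {u, y, z}" using d e by auto
      then have "reserve ?A f u c" using 1 m by (auto simp: reserve_def)
      then show ?thesis using \<open>e \<noteq> {u, y, z}\<close> d by (intro exI[of _ u] exI[of _ c]) auto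
    next
      case 2
      then have "reserve ?A f c u" using g e unfolding reserve_def by auto
      then show ?thesis using 2(1) d by (intro exI[of _ c] exI[of _ u]) auto
    next
      case 3
      then have "reserve ?A f u c" using g e unfolding reserve_def by auto
      moreover have "e \<noteq> {u, y, z}" using 3 by auto
      ultimately show ?thesis using d by (intro exI[of _ u] exI[of _ c]) auto
    qed
  qed
  then obtain w x where w: "{w, x} = {c, u}" "w \<noteq> x" "e \<noteq> {w, y, z}" and res: "reserve ?A f w x"
    by blast
  have wx: "w = c \<and> x = u \<or> w = u \<and> x = c" using w(1) by (auto simp: doubleton_eq_iff)
  have d': "distinct [w, x, y, z]" using wx d by auto
  have B': "{{w, x, y}, {w, x, z}} \<subseteq> B" using wx B by (auto simp: insert_commute)
  have ne: "{w, y, z} \<notin> B"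
  proof -
    have "x \<notin> {w, y, z}" "x \<in> {c, u, y}" "x \<in> {c, u, z}" using d' wx by auto
    then show ?thesis unfolding B by blast
  qed
  have "{w, y, z} \<noteq> f" "{w, y, z} \<noteq> g" using f g(3) by auto
  then have r: "{w, y, z} \<notin> ?A \<union> B" using w(3) ne by auto
  have "holds ?A (insert {w, y, z} B)" if "position ?A (insert {w, y, z} B)"
    using that d' B' wx f res fin by (intro holds_triangle[of _ _ f w x y z]) auto
  moreover have "{w, y, z} \<in> board" using d' by (intro triple_in_board) auto
  moreover have "\<not> has_copy ?A" using fin by (intro not_has_copy_card_less) auto
  ultimately show "\<not> has_copy ?A \<and> (\<exists>r \<in> board. r \<notin> ?A \<union> B \<and>
        (position ?A (insert r B) \<longrightarrow> holds ?A (insert r B)))"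
    using r by metis
qed

text \<open>Distinct triples do not contain each other, which gives \<open>c\<close>. If
  \<open>f\<close> and \<open>g\<close> share two vertices, \<open>g\<close> has at most one vertex
  in \<open>E\<close>, which avoids \<open>f\<close>, so \<open>E\<close> has a second vertex
  outside \<open>g\<close>.\<close>

lemma choose_kernel:
  assumes E: "E \<in> board" "g \<in> board" "E \<noteq> g" "E \<inter> f = {}"
  obtains c u y where "E = {c, u, y}" "distinct [c, u, y]" "c \<notin> g" "meet_once f g \<or> u \<notin> g"
proof -
  have card: "card E = 3" "card g = 3" and fin: "finite E" "finite g"
    using E by (auto simp: board_iff intro: card_ge_0_finite)
  have "\<not> E \<subseteq> g" using card_subset_eq[of g E] card fin E(3) by auto
  then obtain c where c: "c \<in> E" "c \<notin> g" by blast
  have "\<exists>u \<in> E. u \<noteq> c \<and> (meet_once f g \<or> u \<notin> g)"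
  proof (cases "meet_once f g")
    case True
    have "E \<noteq> {c}" using card by auto
    then show ?thesis using True c by blast
  next
    case False
    then obtain a b where ab: "a \<in> f \<inter> g" "b \<in> f \<inter> g" "a \<noteq> b" unfolding meet_once_def by blast
    show ?thesis
    proof (rule ccontr)
      assume "\<not> ?thesis"
      then have "E - {c} \<subseteq> g" using False by blast
      then have "(E - {c}) \<union> {a, b} \<subseteq> g" using ab by auto
      then have "card ((E - {c}) \<union> {a, b}) \<le> 3" using card_mono fin card by metis
      moreover have "card ((E - {c}) \<union> {a, b}) = card (E - {c}) + card {a, b}"
        using ab E(4) fin by (intro card_Un_disjoint) auto
      ultimately show False using c card fin ab(3) by simp
    qed
  qed
  then obtain u where u: "u \<in> E" "u \<noteq> c" "meet_once f g \<or> u \<notin> g" by blast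
  have "card (E - {c, u}) = 1" using card c u fin by (simp add: card_Diff_subset)
  then obtain y where "E - {c, u} = {y}" by (auto simp: card_1_singleton_iff)
  then have "E = {c, u, y}" "distinct [c, u, y]" using c u by auto
  then show ?thesis using that c u by blast
qed

lemma holds_start: "holds {} {}"
proof (rule holdsI)
  show "position {} {}" by (simp add: position_def)
next
  fix f :: "nat set" assume f: "f \<in> board" and pos: "position (insert f {}) {}"
  obtain a where a: "a \<notin> \<Union>{f}" by (rule fresh_vertex[OF pos, of "{}"]) auto
  obtain b where b: "b \<notin> \<Union>{f}" "b \<notin> {a}" by (rule fresh_vertex[OF pos, of "{a}"]) auto
  obtain n where n: "n \<notin> \<Union>{f}" "n \<notin> {a, b}" by (rule fresh_vertex[OF pos, of "{a, b}"]) auto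
  let ?E = "{a, b, n}"
  have E: "?E \<in> board" using a b n by (intro triple_in_board) auto
  have Ef: "?E \<inter> f = {}" "?E \<noteq> f" using a b n by auto
  have "holds {f} {?E}" if pos: "position {f} {?E}"
  proof (rule holdsI[OF pos])
    fix g assume g: "g \<in> board" "g \<notin> {f} \<union> {?E}" and pos': "position (insert g {f}) {?E}"
    \<comment> \<open>The pair \<open>{c, u}\<close> inside the first edge of \<open>P2\<close> is
      chosen only after \<open>g\<close> is known.\<close>
    obtain c u y where k: "?E = {c, u, y}" "distinct [c, u, y]" "c \<notin> g" "meet_once f g \<or> u \<notin> g"
      using choose_kernel[OF E g(1) _ Ef(1)] g(2) by blast
    obtain z where z: "z \<notin> \<Union>(insert g {f})" "z \<notin> \<Union>{?E}" by (rule fresh_vertex[OF pos', of "{}"]) auto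
    have zc: "z \<notin> {c, u, y}" using z(2) unfolding k(1) by simp
    have "{c, u, z} \<in> board" using zc k(2) by (intro triple_in_board) auto
    moreover have "{c, u, z} \<notin> insert g {f} \<union> {?E}" using z by blast
    moreover have "holds (insert g {f}) {{c, u, z}, ?E}" if "position (insert g {f}) {{c, u, z}, ?E}"
    proof -
      have "f \<inter> {c, u, y, z} = {}" using Ef(1) z(1) unfolding k(1) by auto
      moreover have "{{c, u, z}, ?E} = {{c, u, y}, {c, u, z}}" unfolding k(1) by auto
      moreover have "insert g {f} = {f, g}" by auto
      ultimately show ?thesis
        using that k zc z(1) g(2) by (simp only:) (rule holds_two_petals[of f g _ c u y z]; auto)
    qed
    moreover have "\<not> has_copy (insert g {f})" by (intro not_has_copy_card_less) (auto simp: card_insert_if)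
    ultimately show "\<not> has_copy (insert g {f}) \<and> (\<exists>r \<in> board. r \<notin> insert g {f} \<union> {?E} \<and>
        (position (insert g {f}) (insert r {?E}) \<longrightarrow> holds (insert g {f}) (insert r {?E})))"
      by metis
  qed
  moreover have "\<not> has_copy {f}" by (intro not_has_copy_card_less) auto
  moreover have "?E \<notin> {f} \<union> {}" using Ef(2) by simp
  ultimately show "\<not> has_copy {f} \<and> (\<exists>r \<in> board. r \<notin> {f} \<union> {} \<and> (position {f} {r} \<longrightarrow> holds {f} {r}))"
    using E by metis
qed

section \<open>From positions to a strategy\<close>

theorem theorem3p1:
  shows "\<exists>\<sigma> :: nat set list \<Rightarrow> nat set.
    (\<forall>h. odd (length h) \<and> distinct h \<and> set h \<subseteq> board \<longrightarrow> \<sigma> h \<in> board \<and> \<sigma> h \<notin> set h) \<and>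
    (\<forall>p :: nat \<Rightarrow> nat set.
       (\<forall>n. p n \<in> board \<and> p n \<notin> p ` {..<n}) \<and>
       (\<forall>n. odd n \<longrightarrow> p n = \<sigma> (map p [0..<n])) \<longrightarrow>
       (\<forall>n. contains_copy G_vertices G_edges (P1_claims p n) \<longrightarrow>
            contains_copy G_vertices G_edges (P2_claims p n)))"
proof -
  let ?A = "\<lambda>h. P1_claims ((!) h) (length h)" and ?B = "\<lambda>h. P2_claims ((!) h) (length h)"
  define good where "good h r \<longleftrightarrow> r \<in> board \<and> r \<notin> set h \<and> holds (?A h) (insert r (?B h))"
    for h :: "nat set list" and r
  \<comment> \<open>The fallback to any free edge keeps the reply legal on histories that admit no
    good reply, as may happen when \<open>P2\<close> has not followed the strategy.\<close>
  define \<sigma> where "\<sigma> h = (SOME r. if \<exists>r. good h r then good h r else r \<in> board \<and> r \<notin> set h)"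
    for h :: "nat set list"
  have ex: "\<exists>r. r \<in> board \<and> r \<notin> set h" if "set h \<subseteq> board" for h :: "nat set list"
  proof -
    have "position (set h) {}" using that by (simp add: position_def)
    then obtain n where "n \<notin> \<Union>(set h)"
      by (rule fresh_vertex[of _ _ "{}"]) auto
    then have "{n, n + 1, n + 2} \<notin> set h" by blast
    then show ?thesis using triple_in_board[of n "n + 1" "n + 2"] by auto
  qed
  have \<sigma>: "if \<exists>r. good h r then good h (\<sigma> h) else \<sigma> h \<in> board \<and> \<sigma> h \<notin> set h"
    if "set h \<subseteq> board" for h
  proof -
    have "\<exists>r. if \<exists>r. good h r then good h r else r \<in> board \<and> r \<notin> set h"
      using ex[OF that] by auto
    from someI_ex[OF this] show ?thesis unfolding \<sigma>_def .
  qed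
  have legal: "\<sigma> h \<in> board \<and> \<sigma> h \<notin> set h" if "set h \<subseteq> board" for h
    using \<sigma>[OF that] by (auto simp: good_def split: if_splits)
  have "has_copy (P1_claims p n) \<longrightarrow> has_copy (P2_claims p n)"
    if p: "\<And>n. p n \<in> board \<and> p n \<notin> p ` {..<n}" and s: "\<And>n. odd n \<Longrightarrow> p n = \<sigma> (map p [0..<n])"
    for p :: "nat \<Rightarrow> nat set" and n
  proof -
    have claims: "P1_claims p (Suc n) = (if even n then insert (p n) (P1_claims p n) else P1_claims p n)"
      "P2_claims p (Suc n) = (if odd n then insert (p n) (P2_claims p n) else P2_claims p n)" for n
      by (auto simp: P1_claims_def P2_claims_def less_Suc_eq)
    have un: "P1_claims p n \<union> P2_claims p n = p ` {..<n}" for n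
      by (auto simp: P1_claims_def P2_claims_def)
    have hist: "?A (map p [0..<n]) = P1_claims p n" "?B (map p [0..<n]) = P2_claims p n" for n
      by (auto simp: P1_claims_def P2_claims_def) (metis nth_map_upt add_0 diff_zero)+
    \<comment> \<open>At odd \<open>n\<close> it is the turn of \<open>P2\<close>, so the invariant
      promises only that a good reply exists, and \<open>\<sigma>\<close> then picks one. A copy
      owned by \<open>P2\<close> is kept for ever, which makes the first alternative
      persist.\<close>
    define inv where "inv n \<longleftrightarrow> has_copy (P2_claims p n) \<or>
      \<not> has_copy (P1_claims p n) \<and> (if even n then holds (P1_claims p n) (P2_claims p n)
       else \<exists>r \<in> board. r \<notin> p ` {..<n} \<and> holds (P1_claims p n) (insert r (P2_claims p n)))" for n
    have "inv n" for n
    proof (induction n)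
      case 0
      show ?case using holds_start not_has_copy_card_less[of "{}"]
        by (auto simp: inv_def P1_claims_def P2_claims_def)
    next
      case (Suc n)
      show ?case
      proof (cases "has_copy (P2_claims p n)")
        case True
        then have "has_copy (P2_claims p (Suc n))"
          by (rule has_copy_mono) (auto simp: claims)
        then show ?thesis by (simp add: inv_def)
      next
        case False
        show ?thesis
        proof (cases "even n")
          case True
          then have "holds (P1_claims p n) (P2_claims p n)" using Suc False by (simp add: inv_def)
          then have "\<not> has_copy (insert (p n) (P1_claims p n)) \<and> (\<exists>r \<in> board.
            r \<notin> insert (p n) (P1_claims p n) \<union> P2_claims p n \<and>
            holds (insert (p n) (P1_claims p n)) (insert r (P2_claims p n)))"
          proof cases
            case won
            then show ?thesis using False by simp
          next
            case reply
            show ?thesis by (rule reply) (use p[of n] un[of n] in auto)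
          qed
          moreover have "insert (p n) (P1_claims p n) \<union> P2_claims p n = p ` {..<Suc n}"
            using un[of n] by (auto simp: lessThan_Suc)
          ultimately have "\<not> has_copy (insert (p n) (P1_claims p n)) \<and> (\<exists>r \<in> board. r \<notin> p ` {..<Suc n} \<and>
            holds (insert (p n) (P1_claims p n)) (insert r (P2_claims p n)))" by metis
          then show ?thesis using True by (simp add: inv_def claims)
        next
          case odd: False
          let ?h = "map p [0..<n]"
          have sh: "set ?h \<subseteq> board" "set ?h = p ` {..<n}" using p by (auto simp: atLeast0LessThan)
          have nc: "\<not> has_copy (P1_claims p n)" and
            "\<exists>r \<in> board. r \<notin> p ` {..<n} \<and> holds (P1_claims p n) (insert r (P2_claims p n))"
            using Suc False odd by (auto simp: inv_def)
          then have "\<exists>r. good ?h r" unfolding good_def hist sh(2) by blast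
          then have "good ?h (p n)" using \<sigma>[OF sh(1)] s[of n] odd by simp
          then have "holds (P1_claims p n) (insert (p n) (P2_claims p n))"
            unfolding good_def hist by blast
          then show ?thesis using odd nc by (simp add: inv_def claims)
        qed
      qed
    qed
    then show ?thesis by (auto simp: inv_def)
  qed
  then show ?thesis
    unfolding contains_copy_iff using legal by (intro exI[of _ \<sigma>]) blast
qed

end
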